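(* Let $0<q<1$ and $\alpha,\beta>-1$, and let $P_n[z]=P_n^{(\alpha,\beta)}\bigl(\tfrac12(z+z^{-1})\mid q\bigr)$ be the continuous $q$-Jacobi polynomials. Put $$v(z)=(1-q^{\frac12\alpha+\frac14}z)(1+q^{\frac12\beta+\frac14}z)(1-q^{\frac12}z^2)\,z^{-2},$$ $$\tilde v(z)=(1-q^{\frac12\alpha+\frac14}z)(1-q^{\frac12\alpha+\frac34}z)(1+q^{\frac12\beta+\frac14}z)(1+q^{\frac12\beta+\frac34}z)\,z^{-2},$$ $$\gamma_n=2\bigl(q^{\frac12(n+\alpha+\beta+2)}-q^{-\frac12n}\bigr),\qquad \tilde\gamma_n=2\bigl(q^{n+\alpha+\beta+2}-q^{-n}\bigr),$$ $$A_n=\frac{(1-q^{n+1})(1-q^{n+\alpha+\beta+1})}{2q^{\frac12\alpha+\frac14}(1-q^{n+\frac12(\alpha+\beta+1)})(1-q^{n+\frac12(\alpha+\beta+2)})},\qquad C_n=\frac{q^{\frac12\alpha+\frac14}(1-q^{n+\alpha})(1-q^{n+\beta})}{2(1-q^{n+\frac12(\alpha+\beta)})(1-q^{n+\frac12(\alpha+\beta+1)})}.$$ Then for all $n\ge0$ the following two structure relations hold: $$\frac{v(z)P_n[q^{\frac12}z]-v(z^{-1})P_n[q^{-\frac12}z]}{z-z^{-1}}=\gamma_nA_nP_{n+1}[z]-\gamma_{n-1}C_nP_{n-1}[z],$$ $$\frac{\tilde v(z)P_n[qz]-\tilde v(z^{-1})P_n[q^{-1}z]}{z-z^{-1}}=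\tilde\gamma_nA_nP_{n+1}[z]-\tilde\gamma_{n-1}C_nP_{n-1}[z].$$
   Context: $q$-Pochhammer symbols: $(u;q)_n=\prod_{j=0}^{n-1}(1-uq^j)$, $(u_1,\dots,u_r;q)_n=\prod_i(u_i;q)_n$. For polynomials in $x=\tfrac12(z+z^{-1})$ write $f[z]=f(\tfrac12(z+z^{-1}))$. The Askey-Wilson polynomials are $$p_n\bigl(\tfrac12(z+z^{-1});a,b,c,d\mid q\bigr)=\frac{(ab,ac,ad;q)_n}{a^n}\sum_{k=0}^n\frac{(q^{-n},q^{n-1}abcd,az,az^{-1};q)_k}{(ab,ac,ad,q;q)_k}\,q^k.$$ The continuous $q$-Jacobi polynomials are given by either of the two equivalent expressions $$P_n^{(\alpha,\beta)}(x\mid q)=\frac{q^{(\frac12\alpha+\frac14)n}\,p_n\bigl(x;q^{\frac12\alpha+\frac14},-q^{\frac12\beta+\frac14},q^{\frac14},-q^{\frac14}\mid q^{\frac12}\bigr)}{(-q^{\frac12(\alpha+\beta+1)};q^{\frac12})_n\,(q;q)_n}=\frac{q^{(\frac12\alpha+\frac14)n}\,p_n\bigl(x;q^{\frac12\alpha+\frac14},q^{\frac12\alpha+\frac34},-q^{\frac12\beta+\frac14},-q^{\frac12\beta+\frac34}\mid q\bigr)}{(-q^{\frac12(\alpha+\beta+1)};q^{\frac12})_{2n}\,(q;q)_n}.$$ Conventions: $P_{-1}:=0$ and for $n=0$ the term with $P_{-1}$ is $0$; if $\alpha+\beta=-1$ the quotient $(1-q^{\alpha+\beta+1})/(1-q^{\frac12(\alpha+\beta+1)})$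 in $A_0$ is read as $1+q^{\frac12(\alpha+\beta+1)}$. *)

theory Defs
  imports Complex_Main "HOL-Computational_Algebra.Polynomial"
begin

definition qpoch :: "'a::field \<Rightarrow> 'a \<Rightarrow> nat \<Rightarrow> 'a" where
  "qpoch u q n = (\<Prod>j<n. 1 - u * q ^ j)"

definition zeval :: "'a::field poly \<Rightarrow> 'a \<Rightarrow> 'a" where
  "zeval f z = poly f ((z + inverse z) / 2)"

(* The polynomial in x that equals (az, a/z; q)_k for x = (z + 1/z)/2:
   (1 - a q^j z)(1 - a q^j / z) = 1 + (a q^j)^2 - 2 (a q^j) x. *)
definition aw_basis :: "'a::field \<Rightarrow> 'a \<Rightarrow> nat \<Rightarrow> 'a poly" where
  "aw_basis a q k = (\<Prod>j<k. [:1 + (a * q ^ j)^2, - (2 * (a * q ^ j)):])"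

definition askey_wilson :: "nat \<Rightarrow> 'a::field \<Rightarrow> 'a \<Rightarrow> 'a \<Rightarrow> 'a \<Rightarrow> 'a \<Rightarrow> 'a poly" where
  "askey_wilson n a b c d q =
     smult (qpoch (a * b) q n * qpoch (a * c) q n * qpoch (a * d) q n / a ^ n)
       (\<Sum>k\<le>n. smult
          (qpoch (q powi (- int n)) q k * qpoch (q powi (int n - 1) * a * b * c * d) q k /
            (qpoch (a * b) q k * qpoch (a * c) q k * qpoch (a * d) q k * qpoch q q k) * q ^ k)
          (aw_basis a q k))"

lemma zeval_aw_basis:
  fixes z :: "'a::field_char_0"
  assumes "z \<noteq> 0"
  shows "zeval (aw_basis a q k) z = qpoch (a * z) q k * qpoch (a * inverse z) q k"
proof -
  have "1 + (a * q ^ j)^2 - (z + inverse z) * (a * q ^ j)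
      = (1 - a * z * q ^ j) * (1 - a * inverse z * q ^ j)" for j
    using assms by (simp add: field_simps power2_eq_square)
  then show ?thesis
    by (simp add: zeval_def aw_basis_def qpoch_def poly_prod prod.distrib [symmetric])
qed

(* The usual basic hypergeometric formula; since every x has the form (z + 1/z)/2 over the
   complex numbers, it determines the polynomial. *)
lemma zeval_askey_wilson:
  fixes z :: "'a::field_char_0"
  assumes "z \<noteq> 0"
  shows "zeval (askey_wilson n a b c d q) z =
     qpoch (a * b) q n * qpoch (a * c) q n * qpoch (a * d) q n / a ^ n *
     (\<Sum>k\<le>n. qpoch (q powi (- int n)) q k * qpoch (q powi (int n - 1) * a * b * c * d) q k *
               qpoch (a * z) q k * qpoch (a * inverse z) q k /
            (qpoch (a * b) q k * qpoch (a * c) q k * qpoch (a * d) q k * qpoch q q k) * q ^ k)"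
  using zeval_aw_basis [OF assms, of a q]
  unfolding askey_wilson_def zeval_def by (simp add: poly_sum mult_ac)

(* Indexed by the integers, with value 0 at negative indices. *)
definition cont_q_jacobi :: "real \<Rightarrow> real \<Rightarrow> real \<Rightarrow> int \<Rightarrow> complex poly" where
  "cont_q_jacobi q \<alpha> \<beta> n = (if n < 0 then 0 else
     smult (complex_of_real
         (q powr ((\<alpha> / 2 + 1 / 4) * of_int n) /
          (qpoch (- (q powr ((\<alpha> + \<beta> + 1) / 2))) (q powr (1 / 2)) (nat n) * qpoch q q (nat n))))
       (askey_wilson (nat n)
         (complex_of_real (q powr (\<alpha> / 2 + 1 / 4)))
         (complex_of_real (- (q powr (\<beta> / 2 + 1 / 4))))
         (complex_of_real (q powr (1 / 4)))
         (complex_of_real (- (q powr (1 / 4))))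
         (complex_of_real (q powr (1 / 2)))))"

definition v_fun :: "real \<Rightarrow> real \<Rightarrow> real \<Rightarrow> complex \<Rightarrow> complex" where
  "v_fun q \<alpha> \<beta> z =
     (1 - complex_of_real (q powr (\<alpha> / 2 + 1 / 4)) * z) *
     (1 + complex_of_real (q powr (\<beta> / 2 + 1 / 4)) * z) *
     (1 - complex_of_real (q powr (1 / 2)) * z^2) / z^2"

definition v_tilde :: "real \<Rightarrow> real \<Rightarrow> real \<Rightarrow> complex \<Rightarrow> complex" where
  "v_tilde q \<alpha> \<beta> z =
     (1 - complex_of_real (q powr (\<alpha> / 2 + 1 / 4)) * z) *
     (1 - complex_of_real (q powr (\<alpha> / 2 + 3 / 4)) * z) *
     (1 + complex_of_real (q powr (\<beta> / 2 + 1 / 4)) * z) *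
     (1 + complex_of_real (q powr (\<beta> / 2 + 3 / 4)) * z) / z^2"

definition gam :: "real \<Rightarrow> real \<Rightarrow> real \<Rightarrow> int \<Rightarrow> real" where
  "gam q \<alpha> \<beta> n = 2 * (q powr ((of_int n + \<alpha> + \<beta> + 2) / 2) - q powr (- (of_int n / 2)))"

definition gam_tilde :: "real \<Rightarrow> real \<Rightarrow> real \<Rightarrow> int \<Rightarrow> real" where
  "gam_tilde q \<alpha> \<beta> n = 2 * (q powr (of_int n + \<alpha> + \<beta> + 2) - q powr (- of_int n))"

(* For n = 0 and \<alpha> + \<beta> = -1 the factor (1 - q^(\<alpha>+\<beta>+1)) / (1 - q^((\<alpha>+\<beta>+1)/2)) would be 0/0;
   there it is read as 1 + q^((\<alpha>+\<beta>+1)/2). *)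
definition A_coeff :: "real \<Rightarrow> real \<Rightarrow> real \<Rightarrow> int \<Rightarrow> real" where
  "A_coeff q \<alpha> \<beta> n =
    (if n = 0 \<and> \<alpha> + \<beta> = -1
     then (1 - q powr (of_int n + 1)) * (1 + q powr ((\<alpha> + \<beta> + 1) / 2)) /
       (2 * q powr (\<alpha> / 2 + 1 / 4) * (1 - q powr (of_int n + (\<alpha> + \<beta> + 2) / 2)))
     else (1 - q powr (of_int n + 1)) * (1 - q powr (of_int n + \<alpha> + \<beta> + 1)) /
       (2 * q powr (\<alpha> / 2 + 1 / 4) *
        (1 - q powr (of_int n + (\<alpha> + \<beta> + 1) / 2)) *
        (1 - q powr (of_int n + (\<alpha> + \<beta> + 2) / 2))))"

(* The denominator can vanish only for n = 0 (given n \<ge> 0), where C_coeff is multiplied by the zero polynomial. *)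
definition C_coeff :: "real \<Rightarrow> real \<Rightarrow> real \<Rightarrow> int \<Rightarrow> real" where
  "C_coeff q \<alpha> \<beta> n =
     q powr (\<alpha> / 2 + 1 / 4) * (1 - q powr (of_int n + \<alpha>)) * (1 - q powr (of_int n + \<beta>)) /
     (2 * (1 - q powr (of_int n + (\<alpha> + \<beta>) / 2)) *
          (1 - q powr (of_int n + (\<alpha> + \<beta> + 1) / 2)))"

end

theory Submission
  imports Defs
begin

text \<open>
  Put \<open>s = q^(1/2)\<close>, \<open>a = q^(\<alpha>/2+1/4)\<close>, \<open>b = -q^(\<beta>/2+1/4)\<close>. The remaining two Askey--Wilson parameters
  are \<open>\<plusminus> s^(1/2)\<close>, so the Askey--Wilson operator in base \<open>s\<close> is, up to a constant,
  \<open>(D f)[z] = V(z) f[sz] + V(1/z) f[z/s]\<close> with \<open>V(z) = (1-az)(1-bz)/(1-z^2)\<close>, and \<open>D P_n = \<mu>_n P_n\<close> with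
  \<open>\<mu>_n = s^(-n) - a b s^n\<close>. Let \<open>X\<close> be multiplication by \<open>x = (z+1/z)/2\<close>. Applying the commutator \<open>[D, X]\<close>
  to \<open>P_n\<close> and expanding \<open>X P_n\<close> by the three-term recurrence gives the first structure relation.
  The operator \<open>D^2\<close> has outer coefficients \<open>V(z) V(sz)\<close> and \<open>V(1/z) V(s/z)\<close>, while its middle coefficient
  commutes with \<open>X\<close>; hence \<open>[D^2, X]\<close> gives the second relation, and no quadratic transformation between
  the two representations of \<open>P_n\<close> is needed.
\<close>

section \<open>Terminating sums with parameters \<open>c = - d\<close>\<close>

lemma qpoch_0 [simp]: "qpoch u q 0 = 1"
  by (simp add: qpoch_def)

lemma qpoch_Suc: "qpoch u q (Suc n) = qpoch u q n * (1 - u * q ^ n)"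
  by (simp add: qpoch_def)

text \<open>Both sides equal \<open>qpoch u q (Suc n)\<close>, with either the first or the last
  factor split off. Shifts of an argument by the base are handled with it below.\<close>

lemma qpoch_shift: "(1 - u) * qpoch (u * q) q n = qpoch u q n * (1 - u * q ^ n)"
proof (induction n)
  case (Suc n)
  have "(1 - u) * qpoch (u * q) q (Suc n) = ((1 - u) * qpoch (u * q) q n) * (1 - u * q ^ Suc n)"
    by (simp add: qpoch_Suc mult_ac)
  then show ?case by (simp add: Suc qpoch_Suc)
qed simp

lemma qpoch_eq_0: "qpoch u q n = 0 \<longleftrightarrow> (\<exists>j<n. u * q ^ j = 1)"
  by (auto simp: qpoch_def)

text \<open>Factors pair up as (1 - u q^j)(1 + u q^j) = 1 - u^2 q^(2j). With u = a r this merges the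
  symbols of the two parameters \<open>r\<close> and \<open>- r\<close> into a single one in base
  s^2.\<close>

lemma qpoch_times_minus: "qpoch u q n * qpoch (- u) q n = qpoch (u\<^sup>2) (q\<^sup>2) n"
proof (induction n)
  case (Suc n)
  have "(1 - u * q ^ n) * (1 - (- u) * q ^ n) = 1 - u\<^sup>2 * (q\<^sup>2) ^ n"
    by (simp add: algebra_simps power2_eq_square power_mult_distrib flip: power_mult)
  then show ?case
    unfolding qpoch_Suc Suc[symmetric] by (simp only: mult_ac)
qed simp

text \<open>Coefficient of the Askey-Wilson series with c = r, d = -r, r^2 = s: (ac, ad; s)_k
  becomes (a^2 s; s^2)_k and abcd s^(n-1) becomes -ab s^n, so only s occurs and not its root
  r.\<close>

definition jac_coeff :: "'a::field \<Rightarrow> 'a \<Rightarrow> 'a \<Rightarrow> nat \<Rightarrow> nat \<Rightarrow> 'a" where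
  "jac_coeff a b s n k =
     qpoch (inverse (s ^ n)) s k * qpoch (- (a * b) * s ^ n) s k * s ^ k /
     (qpoch (a * b) s k * qpoch (a\<^sup>2 * s) (s\<^sup>2) k * qpoch s s k)"

text \<open>Without the prefactor, the series takes the value 1 at z = a for nonzero
  \<open>a\<close>: every basis element with k > 0 contains the factor 1 - a/z.\<close>

definition jac_sum :: "'a::field \<Rightarrow> 'a \<Rightarrow> 'a \<Rightarrow> nat \<Rightarrow> 'a poly" where
  "jac_sum a b s n = (\<Sum>k\<le>n. smult (jac_coeff a b s n k) (aw_basis a s k))"

lemma askey_wilson_eq_jac_sum:
  fixes a b r s :: "'a::field"
  assumes "r\<^sup>2 = s" "s \<noteq> 0"
  shows "askey_wilson n a b r (- r) s =
    smult (qpoch (a * b) s n * qpoch (a\<^sup>2 * s) (s\<^sup>2) n / a ^ n) (jac_sum a b s n)"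
proof -
  have *: "qpoch (a * r) s k * qpoch (a * - r) s k = qpoch (a\<^sup>2 * s) (s\<^sup>2) k" for k
    using qpoch_times_minus[of "a * r" s k] assms(1) by (simp add: power_mult_distrib)
  \<comment> \<open>For n = 0 the exponent is -1, hence the integer power; the missing factor s
    comes from r * (- r) = - s.\<close>
  have "s powi (int n - 1) * s = s ^ n"
    using assms(2) by (simp add: power_int_diff)
  then have 1: "s powi (int n - 1) * a * b * r * - r = - (a * b) * s ^ n"
    using assms(1) by (simp add: power2_eq_square algebra_simps) (metis mult.assoc mult.left_commute)
  have 2: "s powi (- int n) = inverse (s ^ n)"
    by (simp add: power_int_minus)
  show ?thesis
    unfolding askey_wilson_def jac_sum_def jac_coeff_def 1 2
    by (simp add: mult.assoc flip: *)
qed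

lemma poly_aw_basis_Suc:
  "poly (aw_basis a s (Suc k)) x = poly (aw_basis a s k) x * (1 + (a * s ^ k)\<^sup>2 - 2 * (a * s ^ k) * x)"
  by (simp add: aw_basis_def algebra_simps)

lemma poly_jac_sum: "poly (jac_sum a b s n) x = (\<Sum>k\<le>n. jac_coeff a b s n k * poly (aw_basis a s k) x)"
  by (simp add: jac_sum_def poly_sum)

lemma jac_coeff_0 [simp]: "jac_coeff a b s n 0 = 1"
  by (simp add: jac_coeff_def)

text \<open>The factor with j = n of (s^(-n); s)_k vanishes. Sums over k can therefore be extended
  past n, as the index shifts below require.\<close>

lemma jac_coeff_eq_0:
  assumes "s \<noteq> 0" "n < k"
  shows "jac_coeff a b s n k = 0"
proof -
  have "qpoch (inverse (s ^ n)) s k = 0"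
    unfolding qpoch_eq_0 using assms by (intro exI[of _ n]) auto
  then show ?thesis by (simp add: jac_coeff_def)
qed

text \<open>\<open>s1\<close>, \<open>ab1\<close> and \<open>as1\<close> keep the denominators of
  \<open>jac_coeff\<close> nonzero, \<open>ab2\<close> those of the recurrence coefficients.
  \<open>ab2\<close> starts at exponent 1 because ab = -1 does occur, namely for \<alpha> + \<beta>
  = -1.\<close>

locale jac_params =
  fixes a b s :: "'a::field_char_0"
  assumes a0: "a \<noteq> 0" and s0: "s \<noteq> 0"
    and s1: "\<And>j. s ^ Suc j \<noteq> 1"
    and ab1: "\<And>j. a * b * s ^ j \<noteq> 1"
    and ab2: "\<And>j. a * b * s ^ Suc j \<noteq> - 1"
    and as1: "\<And>j. a\<^sup>2 * s * (s\<^sup>2) ^ j \<noteq> 1"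
begin

abbreviation "c \<equiv> jac_coeff a b s"
abbreviation "\<phi> k \<equiv> zeval (aw_basis a s k)"
definition "\<mu> n = inverse (s ^ n) - a * b * s ^ n"

lemma jac_coeff_Suc:
  "c n (Suc k) * ((1 - a * b * s ^ k) * (1 - a\<^sup>2 * s * (s\<^sup>2) ^ k) * (1 - s ^ Suc k)) =
   c n k * ((1 - inverse (s ^ n) * s ^ k) * (1 + a * b * s ^ n * s ^ k) * s)"
proof -
  have "1 - a * b * s ^ k \<noteq> 0" "1 - a\<^sup>2 * s * (s\<^sup>2) ^ k \<noteq> 0" "1 - s * s ^ k \<noteq> 0"
    using ab1 as1 s1[of k] by auto
  then show ?thesis
    by (simp add: jac_coeff_def qpoch_Suc mult_ac)
qed

section \<open>The eigenvalue equation\<close>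

text \<open>This is D, multiplied by 1 - z^2, on a basis element; the minus sign stems from V(1/z) =
  -(z-a)(z-b)/(1-z^2). All terms share the factor (az, a/z; s)_k, and a rational identity in z and K
  = s^k remains. D is thus triangular, with only one subdiagonal term.\<close>

lemma basis_eigen:
  assumes "z \<noteq> 0"
  shows "(1 - a * z) * (1 - b * z) * \<phi> (Suc k) (s * z) - (z - a) * (z - b) * \<phi> (Suc k) (z / s) =
    (1 - z\<^sup>2) * (\<mu> (Suc k) * \<phi> (Suc k) z +
      (1 - inverse (s ^ Suc k)) * (1 - a * b * s ^ k) * (1 - a\<^sup>2 * s * (s\<^sup>2) ^ k) * \<phi> k z)"
proof -
  define K where "K = s ^ k"
  have K0: "K \<noteq> 0" using s0 by (simp add: K_def)
  define p where "p = qpoch (a * z) s k"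
  define r where "r = qpoch (a * inverse z) s k"
  \<comment> \<open>The prefactor 1 - az completes the shifted symbol to (az; s)_(k+2), and (a/(sz);
    s)_(k+1) is (a/z; s)_k with a new first factor; so p r splits off.\<close>
  have 1: "(1 - a * z) * \<phi> (Suc k) (s * z) = p * r * ((1 - a * z * K) * (1 - a * z * s * K) * (1 - a / (s * z)))"
  proof -
    have "(1 - a * z) * qpoch (a * (s * z)) s (Suc k) = p * ((1 - a * z * K) * (1 - a * z * s * K))"
      using qpoch_shift[of "a * z" s "Suc k"]
      by (simp add: qpoch_Suc p_def K_def mult_ac)
    moreover have "qpoch (a * inverse (s * z)) s (Suc k) = r * (1 - a / (s * z))"
      using qpoch_shift[of "a * inverse (s * z)" s k] s0
      by (simp add: qpoch_Suc r_def field_simps)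
    ultimately show ?thesis
      using assms s0 by (simp add: zeval_aw_basis mult_ac)
  qed
  have 2: "(z - a) * \<phi> (Suc k) (z / s) = p * r * (z * ((1 - a * K / z) * (1 - a * s * K / z) * (1 - a * z / s)))"
  proof -
    have "(1 - a / z) * qpoch (a * inverse (z / s)) s (Suc k) = r * ((1 - a * K / z) * (1 - a * s * K / z))"
      using qpoch_shift[of "a * inverse z" s "Suc k"]
      by (simp add: qpoch_Suc r_def K_def mult_ac divide_inverse)
    moreover have "qpoch (a * (z / s)) s (Suc k) = p * (1 - a * z / s)"
      using qpoch_shift[of "a * (z / s)" s k] s0
      by (simp add: qpoch_Suc p_def field_simps)
    moreover have "z - a = z * (1 - a / z)" using assms by (simp add: field_simps)
    ultimately show ?thesis
      using assms s0 by (simp add: zeval_aw_basis mult_ac)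
  qed
  have 3: "\<phi> (Suc k) z = p * r * ((1 - a * z * K) * (1 - a * K / z))" "\<phi> k z = p * r"
    using assms by (simp_all add: zeval_aw_basis qpoch_Suc p_def r_def K_def divide_inverse mult_ac)
  have 4: "(1 - b * z) * ((1 - a * z * K) * (1 - a * z * s * K) * (1 - a / (s * z)))
     - (z - b) * (z * ((1 - a * K / z) * (1 - a * s * K / z) * (1 - a * z / s)))
     = (1 - z\<^sup>2) * ((inverse (s * K) - a * b * (s * K)) * ((1 - a * z * K) * (1 - a * K / z)) +
      (1 - inverse (s * K)) * (1 - a * b * K) * (1 - a\<^sup>2 * s * K\<^sup>2))"
    using assms s0 K0 by (simp add: field_simps) algebra
  have "(s\<^sup>2) ^ k = K\<^sup>2" by (simp add: K_def mult.commute flip: power_mult)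
  then have "(1 - z\<^sup>2) * (\<mu> (Suc k) * \<phi> (Suc k) z +
      (1 - inverse (s ^ Suc k)) * (1 - a * b * s ^ k) * (1 - a\<^sup>2 * s * (s\<^sup>2) ^ k) * \<phi> k z)
     = p * r * ((1 - z\<^sup>2) * ((inverse (s * K) - a * b * (s * K)) * ((1 - a * z * K) * (1 - a * K / z)) +
      (1 - inverse (s * K)) * (1 - a * b * K) * (1 - a\<^sup>2 * s * K\<^sup>2)))"
    by (simp add: \<mu>_def 3 K_def[symmetric] distrib_left mult_ac)
  also have "\<dots> = (1 - b * z) * ((1 - a * z) * \<phi> (Suc k) (s * z)) - (z - b) * ((z - a) * \<phi> (Suc k) (z / s))"
    unfolding 4[symmetric] 1 2 by (simp add: algebra_simps)
  finally show ?thesis by (simp add: mult_ac)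
qed

text \<open>Since D is triangular on the basis, comparing coefficients turns the eigenvalue equation
  into c_(k+1) e_k = (\<mu>_n - \<mu>_k) c_k, a two-term recursion that is the term ratio of the
  series.\<close>

lemma jac_sum_eigen:
  assumes "z \<noteq> 0"
  shows "(1 - a * z) * (1 - b * z) * zeval (jac_sum a b s n) (s * z)
      - (z - a) * (z - b) * zeval (jac_sum a b s n) (z / s) =
    (1 - z\<^sup>2) * (\<mu> n * zeval (jac_sum a b s n) z)"
proof -
  define e where "e k = (1 - inverse (s ^ Suc k)) * (1 - a * b * s ^ k) * (1 - a\<^sup>2 * s * (s\<^sup>2) ^ k)" for k
  \<comment> \<open>Lower-order part of D on the basis element k; it is 0 for k = 0, since the
    constant 1 is itself an eigenfunction.\<close>
  define W where "W k = (if k = 0 then 0 else e (k - 1) * \<phi> (k - 1) z)" for k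
  have R: "zeval (jac_sum a b s n) y = (\<Sum>k\<le>n. c n k * \<phi> k y)" for y
    by (simp add: zeval_def poly_jac_sum)
  have M: "(1 - a * z) * (1 - b * z) * \<phi> k (s * z) - (z - a) * (z - b) * \<phi> k (z / s) =
      (1 - z\<^sup>2) * (\<mu> k * \<phi> k z + W k)" for k
  proof (cases k)
    case 0
    then show ?thesis
      by (simp add: W_def \<mu>_def zeval_def aw_basis_def algebra_simps power2_eq_square)
  next
    case (Suc j)
    then show ?thesis using basis_eigen[OF assms, of j] by (simp add: W_def e_def)
  qed
  \<comment> \<open>It rests on the factorization \<mu>_n - \<mu>_k = -s^(-k) (1 - s^(k-n)) (1 + ab
    s^(n+k)), whose last two factors occur in the term ratio.\<close>
  have E: "c n (Suc k) * e k = (\<mu> n - \<mu> k) * c n k" for k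
  proof -
    have nz: "s ^ k \<noteq> 0" "s ^ n \<noteq> 0" "1 - s * s ^ k \<noteq> 0" using s0 s1[of k] by auto
    have "c n (Suc k) * e k * (1 - s ^ Suc k) =
       (1 - inverse (s ^ Suc k)) * (c n (Suc k) * ((1 - a * b * s ^ k) * (1 - a\<^sup>2 * s * (s\<^sup>2) ^ k) * (1 - s ^ Suc k)))"
      by (simp add: e_def mult_ac)
    also have "\<dots> = (1 - inverse (s ^ Suc k)) * (c n k * ((1 - inverse (s ^ n) * s ^ k) * (1 + a * b * s ^ n * s ^ k) * s))"
      unfolding jac_coeff_Suc ..
    also have "\<dots> = (\<mu> n - \<mu> k) * c n k * (1 - s ^ Suc k)"
      using nz s0 unfolding \<mu>_def power_Suc by (simp add: divide_simps) algebra
    finally show ?thesis using nz by simp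
  qed
  have "(\<Sum>k\<le>n. c n k * W k) = (\<Sum>k\<le>n. (\<mu> n - \<mu> k) * (c n k * \<phi> k z))"
  proof -
    have "(\<Sum>k\<le>n. c n k * W k) = (\<Sum>k\<le>Suc n. c n k * W k)"
      using s0 by (simp add: jac_coeff_eq_0)
    also have "\<dots> = (\<Sum>k\<le>n. c n (Suc k) * W (Suc k))"
      by (subst sum.atMost_Suc_shift) (simp add: W_def)
    also have "\<dots> = (\<Sum>k\<le>n. (\<mu> n - \<mu> k) * (c n k * \<phi> k z))"
      by (intro sum.cong refl) (simp add: W_def E flip: mult.assoc)
    finally show ?thesis .
  qed
  then have "(\<Sum>k\<le>n. c n k * (\<mu> k * \<phi> k z + W k)) = \<mu> n * (\<Sum>k\<le>n. c n k * \<phi> k z)"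
    by (simp add: sum.distrib distrib_left sum_distrib_left left_diff_distrib right_diff_distrib sum_subtractf mult_ac)
  moreover have "(1 - a * z) * (1 - b * z) * (\<Sum>k\<le>n. c n k * \<phi> k (s * z))
      - (z - a) * (z - b) * (\<Sum>k\<le>n. c n k * \<phi> k (z / s))
      = (\<Sum>k\<le>n. c n k * ((1 - a * z) * (1 - b * z) * \<phi> k (s * z) - (z - a) * (z - b) * \<phi> k (z / s)))"
    by (simp add: sum_distrib_left right_diff_distrib sum_subtractf mult_ac)
  ultimately show ?thesis
    unfolding R M by (simp add: sum_distrib_left[symmetric] mult.left_commute[of _ "1 - z\<^sup>2"])
qed

section \<open>The three-term recurrence\<close>

text \<open>Coefficient of the basis element w + 1 in the three-term recurrence for n = m + 1, with
  N = s^n. \<open>A\<close> and \<open>C\<close> are the Askey-Wilson recurrence coefficients for c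
  = -d; they multiply differences because the middle coefficient is (a + 1/a)/2 - A - C.\<close>

lemma coeff_recurrence:
  assumes N: "N = s ^ Suc m"
    and A: "A = (1 - (a * b * N)\<^sup>2) * (1 - a\<^sup>2 * s * N\<^sup>2) / (2 * a * (1 + a * b * N\<^sup>2) * (1 + a * b * s * N\<^sup>2))"
    and C: "C = a * (1 - b\<^sup>2 * N\<^sup>2 / s) * (1 - N\<^sup>2) / (2 * (1 + a * b * N\<^sup>2 / s) * (1 + a * b * N\<^sup>2))"
  shows "c (Suc m) (Suc w) * ((1 - s ^ Suc w) * (1 - a\<^sup>2 * s ^ Suc w) / (2 * a * s ^ Suc w)) - c (Suc m) w / (2 * a * s ^ w)
    = A * (c (Suc (Suc m)) (Suc w) - c (Suc m) (Suc w)) + C * (c m (Suc w) - c (Suc m) (Suc w))"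
proof -
  \<comment> \<open>The denominators involve ab times s^(2m+1), s^(2m+2) and s^(2m+3), all with
    positive exponents.\<close>
  have "1 + a * b * s ^ Suc j \<noteq> 0" for j using ab2[of j] by (auto simp: add_eq_0_iff)
  from this[of "2 * m + 1"] this[of "2 * m + 2"] this[of "2 * m"]
  have nz': "1 + a * b * N\<^sup>2 \<noteq> 0" "1 + a * b * s * N\<^sup>2 \<noteq> 0" "1 + a * b * s ^ Suc (2 * m) \<noteq> 0"
    by (simp_all add: N mult_ac power2_eq_square power_mult)
  have "s + a * b * N\<^sup>2 = s * (1 + a * b * s ^ Suc (2 * m))"
    by (simp add: N mult_ac distrib_left power2_eq_square power_mult)
  with nz' s0 have nz: "1 + a * b * N\<^sup>2 \<noteq> 0" "1 + a * b * s * N\<^sup>2 \<noteq> 0" "s + a * b * N\<^sup>2 \<noteq> 0"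
    by simp_all
  define J where "J = s ^ w"
  have J0: "J \<noteq> 0" and N0: "N \<noteq> 0" using s0 by (auto simp: J_def N)
  \<comment> \<open>All coefficients are expressed by common pieces: \<open>p'\<close> belongs to
    degree n - 1, \<open>r'\<close> to degree n + 1, \<open>d\<close> collects what does not depend
    on n, and \<open>d'\<close> is the ratio of that part at w + 1 to that at w.\<close>
  define p where "p = qpoch (inverse N) s w"
  define r where "r = qpoch (- (a * b) * N) s w"
  define p' where "p' = qpoch (inverse N * s) s w"
  define r' where "r' = qpoch (- (a * b) * N * s) s w"
  define d where "d = J / (qpoch (a * b) s w * qpoch (a\<^sup>2 * s) (s\<^sup>2) w * qpoch s s w)"
  define d' where "d' = s / ((1 - a * b * J) * (1 - a\<^sup>2 * s * J\<^sup>2) * (1 - s * J))"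
  have J2: "(s\<^sup>2) ^ w = J\<^sup>2" by (simp add: J_def mult.commute flip: power_mult)
  have dnz: "1 - a * b * J \<noteq> 0" "1 - a\<^sup>2 * s * J\<^sup>2 \<noteq> 0" "1 - s * J \<noteq> 0"
    using ab1[of w] as1[of w] s1[of w] J2 by (auto simp: J_def)
  have p': "(1 - inverse N) * p' = p * (1 - J / N)"
    unfolding p_def p'_def qpoch_shift J_def by (simp add: divide_inverse mult_ac)
  have r': "(1 + a * b * N) * r' = r * (1 + a * b * N * J)"
    using qpoch_shift[of "- (a * b) * N" s w] by (simp add: r_def r'_def J_def)
  have c0: "c (Suc m) w = d * p * r"
    by (simp add: jac_coeff_def d_def p_def r_def N J_def)
  have c1: "c (Suc m) (Suc w) = d * d' * (p * r * (1 - J / N) * (1 + a * b * N * J))"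
    unfolding jac_coeff_def N[symmetric]
    using J2 by (simp add: qpoch_Suc d_def d'_def p_def r_def J_def[symmetric] divide_inverse mult_ac)
  have c2: "c (Suc (Suc m)) (Suc w) = d * d' * (p * r' * (1 - inverse (s * N)) * (1 + a * b * N * s * J))"
  proof -
    have "inverse (s * N) * s = inverse N" using s0 by simp
    then have 1: "qpoch (inverse (s * N)) s (Suc w) = (1 - inverse (s * N)) * p"
      using qpoch_shift[of "inverse (s * N)" s w] by (simp only: p_def qpoch_Suc)
    have 2: "s ^ Suc (Suc m) = s * N" by (simp add: N)
    show ?thesis
      unfolding jac_coeff_def 2 1 d_def d'_def r'_def
      using J2 by (simp add: qpoch_Suc J_def[symmetric] divide_inverse mult_ac)
  qed
  have c3: "c m (Suc w) = d * d' * (p' * r * (1 - s * J / N) * (1 + a * b * N / s))"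
  proof -
    have 1: "qpoch (- (a * b) * (N / s)) s (Suc w) = (1 + a * b * N / s) * r"
      using qpoch_shift[of "- (a * b) * (N / s)" s w] s0 by (simp add: r_def qpoch_Suc)
    have 2: "qpoch (inverse (N / s)) s (Suc w) = p' * (1 - s * J / N)"
      by (simp add: p'_def qpoch_Suc J_def divide_inverse mult_ac)
    have 3: "s ^ m = N / s" using s0 by (simp add: N)
    show ?thesis
      unfolding jac_coeff_def 3 1 2 d_def d'_def
      using J2 by (simp add: qpoch_Suc J_def[symmetric] divide_inverse mult_ac)
  qed
  \<comment> \<open>The shift relations give \<open>r'\<close> only after multiplication by 1 + abN
    and \<open>p'\<close> only after multiplication by 1 - 1/N. \<open>A\<close> and
    \<open>C\<close> contain exactly these factors.\<close>
  define A1 where "A1 = (1 - a * b * N) * (1 - a\<^sup>2 * s * N\<^sup>2) / (2 * a * (1 + a * b * N\<^sup>2) * (1 + a * b * s * N\<^sup>2))"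
  define C1 where "C1 = - N * a * (1 - b\<^sup>2 * N\<^sup>2 / s) * (1 + N) / (2 * (1 + a * b * N\<^sup>2 / s) * (1 + a * b * N\<^sup>2))"
  have A': "A = (1 + a * b * N) * A1"
    unfolding A A1_def by (simp add: power2_eq_square algebra_simps)
  have C': "C = (1 - inverse N) * C1"
  proof -
    have "1 - N\<^sup>2 = (1 - inverse N) * (- N * (1 + N))"
      using N0 by (simp add: field_simps power2_eq_square)
    then show ?thesis
      unfolding C C1_def by (simp only: times_divide_eq_right mult_ac)
  qed
  \<comment> \<open>Both differences carry the factor 1 - sJ, as does the left-hand side. Removing d
    d' p r (1 - sJ) throughout leaves \<open>key\<close>.\<close>
  have AA: "A * (c (Suc (Suc m)) (Suc w) - c (Suc m) (Suc w)) =
     d * d' * p * r * ((1 - s * J) * (A1 * (1 + a * b * N * J) * (- (a * b * N) - inverse (s * N))))"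
  proof -
    have "A * (c (Suc (Suc m)) (Suc w) - c (Suc m) (Suc w)) =
      d * d' * p * A1 * ((1 + a * b * N) * r' * ((1 - inverse (s * N)) * (1 + a * b * N * s * J))
       - (1 + a * b * N) * (r * ((1 - J / N) * (1 + a * b * N * J))))"
    proof -
      have "(u * A1) * (e * (p * r' * x * y) - e * (p * r * w * v)) = e * p * A1 * (u * r' * (x * y) - u * (r * (w * v)))"
        for e u v w x y by (simp add: algebra_simps)
      then show ?thesis unfolding A' c1 c2 .
    qed
    also have "\<dots> = d * d' * p * r * (A1 * (1 + a * b * N * J) * ((1 - inverse (s * N)) * (1 + a * b * N * s * J)
       - (1 + a * b * N) * (1 - J / N)))"
    proof -
      have "e * p * A1 * (r * u * x - y * (r * (w * u))) = e * p * r * (A1 * u * (x - y * w))" for e u x y w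
        by (simp add: algebra_simps)
      then show ?thesis unfolding r' .
    qed
    also have "(1 - inverse (s * N)) * (1 + a * b * N * s * J) - (1 + a * b * N) * (1 - J / N)
       = (1 - s * J) * (- (a * b * N) - inverse (s * N))"
      using s0 N0 by (simp add: field_simps)
    finally show ?thesis by (simp only: mult_ac)
  qed
  have CC: "C * (c m (Suc w) - c (Suc m) (Suc w)) =
     d * d' * p * r * ((1 - s * J) * (C1 * (1 - J / N) * (a * b * N / s + inverse N)))"
  proof -
    have "C * (c m (Suc w) - c (Suc m) (Suc w)) =
      d * d' * r * C1 * ((1 - inverse N) * p' * ((1 - s * J / N) * (1 + a * b * N / s))
       - (1 - inverse N) * (p * ((1 - J / N) * (1 + a * b * N * J))))"
    proof -
      have "(u * C1) * (e * (p' * r * x * y) - e * (p * r * w * v)) = e * r * C1 * (u * p' * (x * y) - u * (p * (w * v)))"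
        for e u v w x y by (simp add: algebra_simps)
      then show ?thesis unfolding C' c1 c3 .
    qed
    also have "\<dots> = d * d' * p * r * (C1 * (1 - J / N) * ((1 - s * J / N) * (1 + a * b * N / s)
       - (1 - inverse N) * (1 + a * b * N * J)))"
    proof -
      have "e * r * C1 * (p * w * x - y * (p * (w * v))) = e * p * r * (C1 * w * (x - y * v))" for e v w x y
        by (simp add: algebra_simps)
      then show ?thesis unfolding p' .
    qed
    also have "(1 - s * J / N) * (1 + a * b * N / s) - (1 - inverse N) * (1 + a * b * N * J)
       = (1 - s * J) * (a * b * N / s + inverse N)"
      using s0 N0 by (simp add: field_simps)
    finally show ?thesis by (simp only: mult_ac)
  qed
  have key: "((1 - J / N) * (1 + a * b * N * J) * (1 - a\<^sup>2 * s * J) - (1 - a * b * J) * (1 - a\<^sup>2 * s * J\<^sup>2)) / (2 * a * s * J)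
    = A1 * (1 + a * b * N * J) * (- (a * b * N) - inverse (s * N)) + C1 * (1 - J / N) * (a * b * N / s + inverse N)"
  proof -
    \<comment> \<open>The bracket is -(1 + absN^2)/(sN) and cancels one denominator of
      \<open>A1\<close>; in \<open>g2\<close> the factor 1 + abN^2/s cancels likewise. Only 1 +
      abN^2 survives in both.\<close>
    have g1: "A1 * (- (a * b * N) - inverse (s * N)) = - ((1 - a * b * N) * (1 - a\<^sup>2 * s * N\<^sup>2) / (2 * a * s * N * (1 + a * b * N\<^sup>2)))"
    proof -
      define E where "E = 1 + a * b * s * N\<^sup>2"
      have "- (a * b * N) - inverse (s * N) = - (E / (s * N))"
        unfolding E_def using s0 N0 by (simp add: field_simps power2_eq_square)
      moreover have "E \<noteq> 0" using nz by (simp add: E_def)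
      ultimately show ?thesis unfolding A1_def E_def[symmetric] by (simp add: mult_ac)
    qed
    have g2: "C1 * (a * b * N / s + inverse N) = - (a * (1 - b\<^sup>2 * N\<^sup>2 / s) * (1 + N) / (2 * (1 + a * b * N\<^sup>2)))"
    proof -
      define E where "E = 1 + a * b * N\<^sup>2 / s"
      have "a * b * N / s + inverse N = E / N" "E \<noteq> 0"
        unfolding E_def using s0 N0 nz by (simp_all add: field_simps power2_eq_square)
      then show ?thesis unfolding C1_def E_def[symmetric] using N0
        by (simp add: mult_ac del: left_diff_distrib_numeral right_diff_distrib_numeral)
    qed
    have *: "A1 * (1 + a * b * N * J) * (- (a * b * N) - inverse (s * N)) + C1 * (1 - J / N) * (a * b * N / s + inverse N)
      = - ((1 - a * b * N) * (1 - a\<^sup>2 * s * N\<^sup>2) / (2 * a * s * N * (1 + a * b * N\<^sup>2))) * (1 + a * b * N * J)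
       + - (a * (1 - b\<^sup>2 * N\<^sup>2 / s) * (1 + N) / (2 * (1 + a * b * N\<^sup>2))) * (1 - J / N)"
    proof -
      have "A1 * u * v + C1 * w * x = (A1 * v) * u + (C1 * x) * w" for u v w x
        by (simp add: mult_ac)
      then show ?thesis unfolding g1[symmetric] g2[symmetric] .
    qed
    \<comment> \<open>With t = J/N everything has the denominator 2asNtD. \<open>Y\<close> and
      \<open>Z\<close> are the numerators of the two remaining fractions, and the recurrence comes
      down to the polynomial identity D T = -(tY + NtZ).\<close>
    define t where "t = J / N"
    define D where "D = 1 + a * b * N\<^sup>2"
    define T where "T = (1 - t) * (1 + a * b * N\<^sup>2 * t) * (1 - a\<^sup>2 * s * N * t) - (1 - a * b * N * t) * (1 - a\<^sup>2 * s * N\<^sup>2 * t\<^sup>2)"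
    define Y where "Y = (1 - a * b * N) * (1 - a\<^sup>2 * s * N\<^sup>2) * (1 + a * b * N\<^sup>2 * t)"
    define Z where "Z = (a\<^sup>2 * s - (a * b)\<^sup>2 * N\<^sup>2) * (1 + N) * (1 - t)"
    have t: "J = N * t" "t \<noteq> 0" and D: "D \<noteq> 0" using N0 J0 nz by (simp_all add: t_def D_def)
    have poly: "D * T = - (t * Y + N * t * Z)"
      unfolding D_def T_def Y_def Z_def by algebra
    have "((1 - J / N) * (1 + a * b * N * J) * (1 - a\<^sup>2 * s * J) - (1 - a * b * J) * (1 - a\<^sup>2 * s * J\<^sup>2)) / (2 * a * s * J)
      = D * T / (2 * a * s * N * t * D)"
    proof -
      have "(1 - J / N) * (1 + a * b * N * J) * (1 - a\<^sup>2 * s * J) - (1 - a * b * J) * (1 - a\<^sup>2 * s * J\<^sup>2) = T"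
        unfolding T_def t(1) using N0 by (simp add: power2_eq_square mult_ac)
      then show ?thesis using D t(1) by (simp add: mult_ac)
    qed
    also have "\<dots> = - (Y / (2 * a * s * N * D)) - Z / (2 * a * s * D)"
    proof -
      have "Y / (2 * a * s * N * D) = t * Y / (2 * a * s * N * t * D)"
        "Z / (2 * a * s * D) = N * t * Z / (2 * a * s * N * t * D)"
        using t(2) N0 by simp_all
      then show ?thesis unfolding poly by (simp only: minus_add_distrib diff_conv_add_uminus add_divide_distrib minus_divide_left)
    qed
    also have "Y / (2 * a * s * N * D) = ((1 - a * b * N) * (1 - a\<^sup>2 * s * N\<^sup>2) / (2 * a * s * N * D)) * (1 + a * b * N * J)"
      unfolding Y_def t(1) by (simp add: power2_eq_square mult_ac)
    also have "Z / (2 * a * s * D) = (a * (1 - b\<^sup>2 * N\<^sup>2 / s) * (1 + N) / (2 * D)) * (1 - J / N)"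
    proof -
      have "a\<^sup>2 * s - (a * b)\<^sup>2 * N\<^sup>2 = a * s * (a * (1 - b\<^sup>2 * N\<^sup>2 / s))"
        using s0 by (simp add: field_simps power2_eq_square)
      then show ?thesis unfolding Z_def t_def[symmetric] using a0 s0 by (simp add: mult_ac)
    qed
    finally show ?thesis unfolding * D_def by (simp only: mult_minus_left diff_conv_add_uminus)
  qed
  have "c (Suc m) (Suc w) * ((1 - s ^ Suc w) * (1 - a\<^sup>2 * s ^ Suc w) / (2 * a * s ^ Suc w)) - c (Suc m) w / (2 * a * s ^ w)
    = d * d' * p * r * ((1 - s * J) * (((1 - J / N) * (1 + a * b * N * J) * (1 - a\<^sup>2 * s * J) - (1 - a * b * J) * (1 - a\<^sup>2 * s * J\<^sup>2)) / (2 * a * s * J)))"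
  proof -
    have "c (Suc m) w = d * d' * p * r * ((1 - s * J) * (1 - a * b * J) * (1 - a\<^sup>2 * s * J\<^sup>2)) / s"
      using dnz s0 by (simp add: c0 d'_def)
    moreover have "e * (p * r * u * v) * (w * x / (2 * a * (s * J))) - e * p * r * (w * y * t) / s / (2 * a * J)
      = e * p * r * (w * ((u * v * x - y * t) / (2 * a * s * J)))" for e u v w x y t
      by (simp add: diff_divide_distrib right_diff_distrib mult_ac)
    ultimately show ?thesis
      unfolding c1 power_Suc J_def[symmetric] by simp
  qed
  also have "\<dots> = A * (c (Suc (Suc m)) (Suc w) - c (Suc m) (Suc w)) + C * (c m (Suc w) - c (Suc m) (Suc w))"
    unfolding AA CC key by (simp only: distrib_left)
  finally show ?thesis .
qed

text \<open>The three sums all equal 1 at z = a, where x = (1 + a^2)/(2a); this forces the middle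
  coefficient. The rest is a comparison of coefficients after multiplying each basis element by x -
  (1 + a^2)/(2a).\<close>

lemma jac_sum_recurrence:
  assumes N: "N = s ^ Suc m"
    and A: "A = (1 - (a * b * N)\<^sup>2) * (1 - a\<^sup>2 * s * N\<^sup>2) / (2 * a * (1 + a * b * N\<^sup>2) * (1 + a * b * s * N\<^sup>2))"
    and C: "C = a * (1 - b\<^sup>2 * N\<^sup>2 / s) * (1 - N\<^sup>2) / (2 * (1 + a * b * N\<^sup>2 / s) * (1 + a * b * N\<^sup>2))"
  shows "x * poly (jac_sum a b s (Suc m)) x =
    A * poly (jac_sum a b s (Suc (Suc m))) x + ((1 + a\<^sup>2) / (2 * a) - A - C) * poly (jac_sum a b s (Suc m)) x
    + C * poly (jac_sum a b s m) x"
proof -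
  define \<psi> where "\<psi> k = poly (aw_basis a s k) x" for k
  define g where "g k = (1 - s ^ k) * (1 - a\<^sup>2 * s ^ k) / (2 * a * s ^ k)" for k
  define D where "D k = A * (c (Suc (Suc m)) k - c (Suc m) k) + C * (c m k - c (Suc m) k)" for k
  have R: "poly (jac_sum a b s n) x = (\<Sum>k\<le>Suc (Suc m). c n k * \<psi> k)" if "n \<le> Suc (Suc m)" for n
    unfolding poly_jac_sum \<psi>_def using that s0
    by (intro sum.mono_neutral_left) (auto simp: jac_coeff_eq_0)
  have x: "(x - (1 + a\<^sup>2) / (2 * a)) * \<psi> k = g k * \<psi> k - \<psi> (Suc k) / (2 * a * s ^ k)" for k
    unfolding \<psi>_def poly_aw_basis_Suc g_def using a0 s0 by (simp add: field_simps power2_eq_square)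
  have "(x - (1 + a\<^sup>2) / (2 * a)) * poly (jac_sum a b s (Suc m)) x =
      (\<Sum>k\<le>Suc (Suc m). c (Suc m) k * (g k * \<psi> k - \<psi> (Suc k) / (2 * a * s ^ k)))"
    by (simp only: R[of "Suc m"] sum_distrib_left x[symmetric] mult.left_commute le_SucI order_refl)
  also have "\<dots> = (\<Sum>k\<le>Suc (Suc m). c (Suc m) k * (g k * \<psi> k))
      - (\<Sum>k\<le>Suc m. c (Suc m) k * (\<psi> (Suc k) / (2 * a * s ^ k)))"
    using s0 by (simp add: right_diff_distrib sum_subtractf jac_coeff_eq_0)
  \<comment> \<open>The term k = 0 drops out because g 0 = 0; in the same way D 0 = 0 below, as all
    the constant coefficients are 1.\<close>
  also have "\<dots> = (\<Sum>k\<le>Suc m. (c (Suc m) (Suc k) * g (Suc k) - c (Suc m) k / (2 * a * s ^ k)) * \<psi> (Suc k))"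
    unfolding sum.atMost_Suc_shift[of _ "Suc m"]
    by (simp add: g_def[of 0] left_diff_distrib sum_subtractf mult.assoc del: sum.atMost_Suc)
  also have "\<dots> = (\<Sum>k\<le>Suc m. D (Suc k) * \<psi> (Suc k))"
    unfolding g_def D_def coeff_recurrence[OF assms] ..
  also have "\<dots> = (\<Sum>k\<le>Suc (Suc m). D k * \<psi> k)"
    unfolding sum.atMost_Suc_shift[of _ "Suc m"] by (simp add: D_def del: sum.atMost_Suc)
  also have "\<dots> = A * (poly (jac_sum a b s (Suc (Suc m))) x - poly (jac_sum a b s (Suc m)) x)
      + C * (poly (jac_sum a b s m) x - poly (jac_sum a b s (Suc m)) x)"
    by (simp add: R D_def sum_distrib_left sum_subtractf sum.distrib algebra_simps del: sum.atMost_Suc)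
  finally show ?thesis by (simp add: algebra_simps)
qed

text \<open>At N = 1 the factor 1 + ab is cancelled from \<open>A\<close>, so the formula stays
  valid for ab = -1; \<open>C\<close> would contain 1 - N^2 = 0. For this linear polynomial the
  claim reduces to A c_1 = -1/(2a).\<close>

lemma jac_sum_recurrence_0:
  assumes A: "A = (1 - a * b) * (1 - a\<^sup>2 * s) / (2 * a * (1 + a * b * s))"
  shows "x = A * poly (jac_sum a b s 1) x + ((1 + a\<^sup>2) / (2 * a) - A)"
proof -
  have nz: "1 - a * b \<noteq> 0" "1 - a\<^sup>2 * s \<noteq> 0" "1 - s \<noteq> 0" "1 + a * b * s \<noteq> 0"
    using ab1[of 0] as1[of 0] s1[of 0] ab2[of 0] by (auto simp: add_eq_0_iff)
  have "c 0 1 = 0" using s0 by (simp add: jac_coeff_eq_0)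
  have "c 1 1 * ((1 - a * b) * (1 - a\<^sup>2 * s) * (1 - s)) = (1 - inverse s) * (1 + a * b * s) * s"
    using jac_coeff_Suc[of 1 0] by simp
  also have "\<dots> = - (1 + a * b * s) * (1 - s)"
    using s0 by (simp add: field_simps)
  finally have "c 1 1 * ((1 - a * b) * (1 - a\<^sup>2 * s)) * (1 - s) = - (1 + a * b * s) * (1 - s)"
    by (simp only: mult.assoc)
  then have "c 1 1 * ((1 - a * b) * (1 - a\<^sup>2 * s)) = - (1 + a * b * s)"
    using nz(3) mult_right_cancel by blast
  then have "c 1 1 = - (1 + a * b * s) / ((1 - a * b) * (1 - a\<^sup>2 * s))"
    using nz by (simp only: nonzero_eq_divide_eq mult_eq_0_iff simp_thms)
  then have "A * c 1 1 = - 1 / (2 * a)"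
  proof -
    have "- (1 + a * b * s) / (2 * a * (1 + a * b * s)) = - 1 / (2 * a)"
      using nz by (simp only: minus_divide_left[symmetric]) simp
    then show ?thesis
      unfolding A \<open>c 1 1 = _\<close> using nz(1,2) by simp
  qed
  moreover have "poly (jac_sum a b s 1) x = 1 + c 1 1 * (1 + a\<^sup>2 - 2 * a * x)"
    by (simp add: poly_jac_sum aw_basis_def algebra_simps)
  ultimately show ?thesis
    using a0 by (simp add: distrib_left mult.assoc[symmetric]) (simp add: field_simps)
qed

section \<open>The normalized polynomials and their recurrence\<close>

definition "h n = qpoch (a\<^sup>2 * s) (s\<^sup>2) n / qpoch (s\<^sup>2) (s\<^sup>2) n"
text \<open>\<open>h n\<close> is the value at z = a; for the q-Jacobi parameters it is
  (q^(\<alpha>+1); q)_n / (q; q)_n.\<close>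

definition "P n = smult (h n) (jac_sum a b s n)"

text \<open>Cleared of the denominator \<open>1 - z^2\<close> of \<open>D\<close>, the eigenvalue equation makes sense at \<open>z = \<plusminus>1\<close> as well.\<close>
definition eigenpoly :: "'a poly \<Rightarrow> 'a \<Rightarrow> bool" where
  "eigenpoly p l \<longleftrightarrow> (\<forall>z. z \<noteq> 0 \<longrightarrow>
     (1 - a * z) * (1 - b * z) * zeval p (s * z) - (z - a) * (z - b) * zeval p (z / s) =
     (1 - z\<^sup>2) * (l * zeval p z))"

text \<open>Lets the zero polynomial stand for P_(-1) with whatever eigenvalue the formula gives
  there.\<close>

lemma eigenpoly_0: "eigenpoly 0 l"
  by (simp add: eigenpoly_def zeval_def)

lemma eigenpoly_P: "eigenpoly (P n) (\<mu> n)"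
  unfolding eigenpoly_def
proof (intro allI impI)
  fix z :: 'a assume "z \<noteq> 0"
  have "zeval (P n) y = h n * zeval (jac_sum a b s n) y" for y
    by (simp add: P_def zeval_def)
  then show "(1 - a * z) * (1 - b * z) * zeval (P n) (s * z) - (z - a) * (z - b) * zeval (P n) (z / s) =
     (1 - z\<^sup>2) * (\<mu> n * zeval (P n) z)"
    using arg_cong[OF jac_sum_eigen[OF \<open>z \<noteq> 0\<close>, of n], of "\<lambda>t. h n * t"]
    by (simp add: right_diff_distrib mult_ac)
qed

lemma h_Suc: "h (Suc n) * (1 - s\<^sup>2 * (s ^ n)\<^sup>2) = h n * (1 - a\<^sup>2 * s * (s ^ n)\<^sup>2)"
proof -
  have "s\<^sup>2 * (s\<^sup>2) ^ n \<noteq> 1"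
    using s1[of "2 * n + 1"] by (simp add: power_mult power2_eq_square mult.assoc)
  then show ?thesis
    by (simp add: h_def qpoch_Suc power_mult[symmetric] mult.commute[of 2 n])
qed

text \<open>Renormalizing by \<open>h\<close> replaces 1 - a^2 s N^2 in the upper coefficient by 1 -
  s^2 N^2, and 1 - N^2 in the lower one by 1 - a^2 N^2/s. The middle coefficient stays unnamed
  because it cancels in the commutator.\<close>

lemma P_recurrence:
  assumes N: "N = s ^ Suc m"
    and A: "A = (1 - s\<^sup>2 * N\<^sup>2) * (1 - (a * b * N)\<^sup>2) / (2 * a * (1 + a * b * N\<^sup>2) * (1 + a * b * s * N\<^sup>2))"
    and C: "C = a * (1 - a\<^sup>2 * N\<^sup>2 / s) * (1 - b\<^sup>2 * N\<^sup>2 / s) / (2 * (1 + a * b * N\<^sup>2 / s) * (1 + a * b * N\<^sup>2))"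
  obtains B where "\<And>x. x * poly (P (Suc m)) x = A * poly (P (Suc (Suc m))) x + B * poly (P (Suc m)) x + C * poly (P m) x"
proof -
  define A' where "A' = (1 - (a * b * N)\<^sup>2) * (1 - a\<^sup>2 * s * N\<^sup>2) / (2 * a * (1 + a * b * N\<^sup>2) * (1 + a * b * s * N\<^sup>2))"
  define C' where "C' = a * (1 - b\<^sup>2 * N\<^sup>2 / s) * (1 - N\<^sup>2) / (2 * (1 + a * b * N\<^sup>2 / s) * (1 + a * b * N\<^sup>2))"
  have "A' * h (Suc m) = A * h (Suc (Suc m))"
    using h_Suc[of "Suc m"] unfolding A'_def A N[symmetric] by (simp add: mult_ac)
  moreover have "C' * h (Suc m) = C * h m"
  proof -
    have "h (Suc m) * (1 - N\<^sup>2) = h m * (1 - a\<^sup>2 * N\<^sup>2 / s)"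
      using h_Suc[of m] s0 by (simp add: N power2_eq_square mult_ac)
    then show ?thesis unfolding C'_def C by (simp add: mult_ac)
  qed
  ultimately have hA: "A' * h (Suc m) = A * h (Suc (Suc m))" and hC: "C' * h (Suc m) = C * h m" .
  have "x * poly (P (Suc m)) x = A * poly (P (Suc (Suc m))) x
      + ((1 + a\<^sup>2) / (2 * a) - A' - C') * poly (P (Suc m)) x + C * poly (P m) x" for x
  proof -
    define B where "B = (1 + a\<^sup>2) / (2 * a) - A' - C'"
    have "x * poly (P (Suc m)) x = h (Suc m) * (x * poly (jac_sum a b s (Suc m)) x)"
      by (simp add: P_def)
    also have "\<dots> = (A' * h (Suc m)) * poly (jac_sum a b s (Suc (Suc m))) x
        + B * (h (Suc m) * poly (jac_sum a b s (Suc m)) x) + (C' * h (Suc m)) * poly (jac_sum a b s m) x"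
      unfolding jac_sum_recurrence[OF N A'_def C'_def] B_def[symmetric] by (simp add: distrib_left mult_ac)
    finally show ?thesis
      unfolding hA hC by (simp add: P_def B_def mult.assoc)
  qed
  then show thesis by (rule that)
qed

lemma P_recurrence_0:
  assumes A: "A = (1 - s\<^sup>2) * (1 - a * b) / (2 * a * (1 + a * b * s))"
  obtains B where "\<And>x. x * poly (P 0) x = A * poly (P 1) x + B * poly (P 0) x"
proof -
  define A' where "A' = (1 - a * b) * (1 - a\<^sup>2 * s) / (2 * a * (1 + a * b * s))"
  have "A' = A * h 1"
    using h_Suc[of 0] unfolding A'_def A by (simp add: h_def[of 0] mult_ac)
  then have "x * poly (P 0) x = A * poly (P 1) x + ((1 + a\<^sup>2) / (2 * a) - A') * poly (P 0) x" for x
    using jac_sum_recurrence_0[OF A'_def, of x] by (simp add: P_def h_def[of 0] poly_jac_sum aw_basis_def mult_ac)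
  then show thesis by (rule that)
qed

end

section \<open>Structure relations from commutators\<close>

text \<open>The commutator with \<open>X\<close> of the operator \<open>V f[y1] + W f[y2] + U f[z]\<close>, applied to \<open>f\<close>; the term \<open>U\<close> drops out.\<close>
lemma commutator_eigenfunctions:
  fixes f g k X :: "'b \<Rightarrow> 'a::comm_ring_1"
  assumes rec: "\<And>y. X y * f y = A * g y + B * f y + C * k y"
    and "V * f y1 + W * f y2 + U * f z = l * f z"
    and "V * g y1 + W * g y2 + U * g z = lg * g z"
    and "V * k y1 + W * k y2 + U * k z = lk * k z"
  shows "V * (X y1 - X z) * f y1 + W * (X y2 - X z) * f y2 = A * (lg - l) * g z + C * (lk - l) * k z"
proof -
  have "V * (X y1 - X z) * f y1 + W * (X y2 - X z) * f y2 =
     V * (X y1 * f y1) + W * (X y2 * f y2) + U * (X z * f z) - X z * (V * f y1 + W * f y2 + U * f z)"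
    by (simp add: algebra_simps)
  also have "V * (X y1 * f y1) + W * (X y2 * f y2) + U * (X z * f z) =
     A * (V * g y1 + W * g y2 + U * g z) + B * (V * f y1 + W * f y2 + U * f z)
     + C * (V * k y1 + W * k y2 + U * k z)"
    unfolding rec by (simp only: distrib_left mult_ac add_ac)
  also have "\<dots> - X z * (V * f y1 + W * f y2 + U * f z) =
     A * (lg * g z) + B * (l * f z) + C * (lk * k z) - l * (X z * f z)"
    unfolding assms(2-4) by (simp only: mult_ac)
  also have "\<dots> = A * (lg - l) * g z + C * (lk - l) * k z"
    unfolding rec by (simp add: algebra_simps)
  finally show ?thesis .
qed

context jac_params
begin

definition "V z = (1 - a * z) * (1 - b * z) / (1 - z\<^sup>2)"
text \<open>For nonzero z this is V(1/z), with the inverses cleared.\<close>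

definition "W z = - ((z - a) * (z - b) / (1 - z\<^sup>2))"

lemma eigenpolyD:
  assumes "eigenpoly p l" "z \<noteq> 0" "z\<^sup>2 \<noteq> 1"
  shows "V z * zeval p (s * z) + W z * zeval p (z / s) = l * zeval p z"
proof -
  have "V z * zeval p (s * z) + W z * zeval p (z / s) =
    ((1 - a * z) * (1 - b * z) * zeval p (s * z) - (z - a) * (z - b) * zeval p (z / s)) / (1 - z\<^sup>2)"
    unfolding V_def W_def by (simp add: diff_divide_distrib)
  then show ?thesis using assms by (simp add: eigenpoly_def)
qed

text \<open>The commutator multiplies V(z) by X(sz) - X(z), which is proportional to (1 - sz^2)/z:
  this supplies the third factor of \<open>v\<close> and the constant 2s/(1-s).\<close>

lemma structure_relation_s:
  assumes rec: "\<And>x. x * poly f x = A * poly g x + B * poly f x + C * poly k x"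
    and eig: "eigenpoly f l" "eigenpoly g lg" "eigenpoly k lk"
    and z: "z \<noteq> 0" "z\<^sup>2 \<noteq> 1"
  defines "v \<equiv> \<lambda>z. (1 - a * z) * (1 - b * z) * (1 - s * z\<^sup>2) / z\<^sup>2"
  shows "(v z * zeval f (s * z) - v (inverse z) * zeval f (z / s)) / (z - inverse z) =
    2 * s / (1 - s) * ((l - lg) * A * zeval g z + (l - lk) * C * zeval k z)"
proof -
  define X where "X y = (y + inverse y) / 2" for y :: 'a
  have r1: "- K * p * F - K * r * G = - K * (p * F + r * G)" for K p r F G :: 'a
    by (simp add: algebra_simps)
  have r2: "- K * (A * (lg' - l') * G + C * (lk' - l') * H) = K * ((l' - lg') * A * G + (l' - lk') * C * H)"
    for K G H l' lg' lk' :: 'a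
    by (simp add: algebra_simps)
  have sn: "1 - s \<noteq> 0" using s1[of 0] by simp
  have zn: "1 - z\<^sup>2 \<noteq> 0" using z by auto
  have zi: "z - inverse z = - ((1 - z\<^sup>2) / z)"
    using z by (simp add: field_simps power2_eq_square)
  have X1: "X (s * z) - X z = (1 - s) * (1 - s * z\<^sup>2) / (2 * s * z)"
    unfolding X_def using z s0 by (simp add: field_simps power2_eq_square)
  have X2: "X (z / s) - X z = (1 - s) * (z\<^sup>2 - s) / (2 * s * z)"
    unfolding X_def using z s0 by (simp add: field_simps power2_eq_square)
  have comm: "V z * (X (s * z) - X z) * zeval f (s * z) + W z * (X (z / s) - X z) * zeval f (z / s)
      = A * (lg - l) * zeval g z + C * (lk - l) * zeval k z"
    by (rule commutator_eigenfunctions[where U = 0 and B = B])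
      (use rec eig[THEN eigenpolyD, OF z] in \<open>auto simp: zeval_def X_def\<close>)
  have v1: "v z / (z - inverse z) = - (2 * s / (1 - s)) * (V z * (X (s * z) - X z))"
    unfolding X1 v_def V_def zi using z zn sn s0
    by (simp add: power2_eq_square mult_ac del: left_diff_distrib_numeral right_diff_distrib_numeral)
  have v2: "v (inverse z) / (z - inverse z) = 2 * s / (1 - s) * (W z * (X (z / s) - X z))"
  proof -
    have "v (inverse z) = (z - a) * (z - b) * (z\<^sup>2 - s) / z\<^sup>2"
      unfolding v_def using z by (simp add: field_simps power2_eq_square)
    then show ?thesis
      unfolding X2 W_def zi using z zn sn s0
      by (simp add: power2_eq_square mult_ac del: left_diff_distrib_numeral right_diff_distrib_numeral)
  qed
  have "(v z * zeval f (s * z) - v (inverse z) * zeval f (z / s)) / (z - inverse z) =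
    v z / (z - inverse z) * zeval f (s * z) - v (inverse z) / (z - inverse z) * zeval f (z / s)"
    by (simp add: diff_divide_distrib)
  also have "\<dots> = - (2 * s / (1 - s)) * (V z * (X (s * z) - X z) * zeval f (s * z)
      + W z * (X (z / s) - X z) * zeval f (z / s))"
    unfolding v1 v2 by (rule r1)
  also have "\<dots> = 2 * s / (1 - s) * ((l - lg) * A * zeval g z + (l - lk) * C * zeval k z)"
    unfolding comm by (rule r2)
  finally show ?thesis .
qed

text \<open>The same commutator argument for D^2, with squared eigenvalues. Applying D twice
  evaluates it at sz and z/s too, hence the extra conditions on z.\<close>

lemma structure_relation_s_squared:
  assumes rec: "\<And>x. x * poly f x = A * poly g x + B * poly f x + C * poly k x"
    and eig: "eigenpoly f l" "eigenpoly g lg" "eigenpoly k lk"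
    and z: "z \<noteq> 0" "z\<^sup>2 \<noteq> 1" "(s * z)\<^sup>2 \<noteq> 1" "(z / s)\<^sup>2 \<noteq> 1"
  defines "v \<equiv> \<lambda>z. (1 - a * z) * (1 - a * s * z) * (1 - b * z) * (1 - b * s * z) / z\<^sup>2"
  shows "(v z * zeval f (s\<^sup>2 * z) - v (inverse z) * zeval f (z / s\<^sup>2)) / (z - inverse z) =
    2 * s\<^sup>2 / (1 - s\<^sup>2) * ((l\<^sup>2 - lg\<^sup>2) * A * zeval g z + (l\<^sup>2 - lk\<^sup>2) * C * zeval k z)"
proof -
  define X where "X y = (y + inverse y) / 2" for y :: 'a
  have r1: "- K * p * F - K * r * G = - K * (p * F + r * G)" for K p r F G :: 'a
    by (simp add: algebra_simps)
  have r2: "- K * (A * (lg' - l') * G + C * (lk' - l') * H) = K * ((l' - lg') * A * G + (l' - lk') * C * H)"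
    for K G H l' lg' lk' :: 'a
    by (simp add: algebra_simps)
  have sn: "1 - s\<^sup>2 \<noteq> 0" using s1[of 1] by (simp add: power2_eq_square)
  have zn: "1 - z\<^sup>2 \<noteq> 0" "1 - (s * z)\<^sup>2 \<noteq> 0" "1 - (z / s)\<^sup>2 \<noteq> 0" using z by auto
  have zi: "z - inverse z = - ((1 - z\<^sup>2) / z)"
    using z by (simp add: field_simps power2_eq_square)
  \<comment> \<open>The factor 1 - (sz)^2 cancels the denominator of V(sz), and 1 - (z/s)^2 in
    \<open>X2\<close> that of W(z/s). Therefore \<open>v\<close> has no poles there.\<close>
  have X1: "X (s\<^sup>2 * z) - X z = (1 - s\<^sup>2) * (1 - (s * z)\<^sup>2) / (2 * s\<^sup>2 * z)"
    unfolding X_def using z s0 by (simp add: field_simps power2_eq_square)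
  have X2: "X (z / s\<^sup>2) - X z = - ((1 - s\<^sup>2) * (1 - (z / s)\<^sup>2) / (2 * z))"
    unfolding X_def using z s0 by (simp add: field_simps power2_eq_square)
  \<comment> \<open>The eigenvalue equations at sz and z/s are inserted into the one at z. Both
    contribute a multiple of p at z, the middle coefficient.\<close>
  have e: "(V z * V (s * z)) * zeval p (s\<^sup>2 * z) + (W z * W (z / s)) * zeval p (z / s\<^sup>2)
      + (V z * W (s * z) + W z * V (z / s)) * zeval p z = l\<^sup>2 * zeval p z"
    if "eigenpoly p l" for p l
  proof -
    have 1: "V (s * z) * zeval p (s\<^sup>2 * z) + W (s * z) * zeval p z = l * zeval p (s * z)"
      using eigenpolyD[OF that, of "s * z"] z s0 by (simp add: power2_eq_square mult.assoc)
    have 2: "V (z / s) * zeval p z + W (z / s) * zeval p (z / s\<^sup>2) = l * zeval p (z / s)"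
      using eigenpolyD[OF that, of "z / s"] z s0 by (simp add: power2_eq_square)
    have "l\<^sup>2 * zeval p z = l * (V z * zeval p (s * z) + W z * zeval p (z / s))"
      unfolding eigenpolyD[OF that z(1,2)] by (simp add: power2_eq_square)
    also have "\<dots> = V z * (l * zeval p (s * z)) + W z * (l * zeval p (z / s))"
      by (simp add: algebra_simps)
    finally show ?thesis
      unfolding 1[symmetric] 2[symmetric] by (simp add: algebra_simps)
  qed
  have comm: "(V z * V (s * z)) * (X (s\<^sup>2 * z) - X z) * zeval f (s\<^sup>2 * z)
      + (W z * W (z / s)) * (X (z / s\<^sup>2) - X z) * zeval f (z / s\<^sup>2)
      = A * (lg\<^sup>2 - l\<^sup>2) * zeval g z + C * (lk\<^sup>2 - l\<^sup>2) * zeval k z"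
    by (rule commutator_eigenfunctions[where U = "V z * W (s * z) + W z * V (z / s)" and B = B])
      (use rec e eig in \<open>simp_all add: zeval_def X_def\<close>)
  have v1: "v z / (z - inverse z) = - (2 * s\<^sup>2 / (1 - s\<^sup>2)) * ((V z * V (s * z)) * (X (s\<^sup>2 * z) - X z))"
  proof -
    define D E T where "D = 1 - z\<^sup>2" and "E = 1 - (s * z)\<^sup>2" and "T = 1 - s\<^sup>2"
    have "v z = (1 - a * z) * (1 - b * z) * ((1 - a * (s * z)) * (1 - b * (s * z))) / z\<^sup>2"
      by (simp add: v_def mult_ac)
    moreover have "D \<noteq> 0" "E \<noteq> 0" "T \<noteq> 0" using zn sn by (simp_all add: D_def E_def T_def)
    ultimately show ?thesis
      unfolding X1 V_def zi D_def[symmetric] E_def[symmetric] T_def[symmetric]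
      using z s0
      by (simp add: power2_eq_square mult_ac del: left_diff_distrib_numeral right_diff_distrib_numeral)
  qed
  have v2: "v (inverse z) / (z - inverse z) = 2 * s\<^sup>2 / (1 - s\<^sup>2) * ((W z * W (z / s)) * (X (z / s\<^sup>2) - X z))"
  proof -
    define D E T where "D = 1 - z\<^sup>2" and "E = 1 - (z / s)\<^sup>2" and "T = 1 - s\<^sup>2"
    have nz: "D \<noteq> 0" "E \<noteq> 0" "T \<noteq> 0" using zn sn by (simp_all add: D_def E_def T_def)
    have "v (inverse z) = (z - a) * (z - b) * ((z / s - a) * (z / s - b)) * s\<^sup>2 / z\<^sup>2"
    proof -
      have "1 - a * inverse z = (z - a) / z" "1 - b * inverse z = (z - b) / z"
        "1 - a * s * inverse z = (z / s - a) * s / z" "1 - b * s * inverse z = (z / s - b) * s / z"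
        using z s0 by (simp_all add: field_simps)
      then show ?thesis
        unfolding v_def using z by (simp add: power2_eq_square mult_ac)
    qed
    then show ?thesis
      unfolding X2 W_def zi D_def[symmetric] E_def[symmetric] T_def[symmetric]
      using z s0 nz
      by (simp add: power2_eq_square mult_ac del: left_diff_distrib_numeral right_diff_distrib_numeral)
  qed
  have "(v z * zeval f (s\<^sup>2 * z) - v (inverse z) * zeval f (z / s\<^sup>2)) / (z - inverse z) =
    v z / (z - inverse z) * zeval f (s\<^sup>2 * z) - v (inverse z) / (z - inverse z) * zeval f (z / s\<^sup>2)"
    by (simp add: diff_divide_distrib)
  also have "\<dots> = - (2 * s\<^sup>2 / (1 - s\<^sup>2)) * ((V z * V (s * z)) * (X (s\<^sup>2 * z) - X z) * zeval f (s\<^sup>2 * z)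
      + (W z * W (z / s)) * (X (z / s\<^sup>2) - X z) * zeval f (z / s\<^sup>2))"
    unfolding v1 v2 by (rule r1)
  also have "\<dots> = 2 * s\<^sup>2 / (1 - s\<^sup>2) * ((l\<^sup>2 - lg\<^sup>2) * A * zeval g z + (l\<^sup>2 - lk\<^sup>2) * C * zeval k z)"
    unfolding comm by (rule r2)
  finally show ?thesis .
qed

end

section \<open>Extension of identities across finitely many points\<close>

lemma isCont_zeval:
  fixes p :: "complex poly"
  assumes "isCont g z" "g z \<noteq> 0"
  shows "isCont (\<lambda>z. zeval p (g z)) z"
  unfolding zeval_def using assms by (intro continuous_intros isCont_o2[OF _ poly_isCont]) auto

lemma eq_of_eq_off_finite:
  fixes f g :: "complex \<Rightarrow> complex"
  assumes "isCont f z" "isCont g z" "finite S" "\<And>y. y \<notin> S \<Longrightarrow> f y = g y"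
  shows "f z = g z"
proof -
  \<comment> \<open>The limit at z ignores z itself, so only the other points of \<open>S\<close>
    must be avoided; z may belong to \<open>S\<close>.\<close>
  have "open (- (S - {z}))" using assms(3) by (intro open_Compl finite_imp_closed) auto
  then have "eventually (\<lambda>y. f y = g y) (at z)"
    unfolding eventually_at_topological using assms(4) by (intro exI[of _ "- (S - {z})"]) auto
  then have "(g \<longlongrightarrow> f z) (at z)"
    using assms(1) unfolding isCont_def by (rule Lim_transform_eventually[rotated])
  then show ?thesis
    using assms(2) unfolding isCont_def by (rule LIM_unique)
qed

lemma of_real_combination:
  "of_real K * ((of_real x - of_real y) * of_real A * G + (of_real x - of_real w) * of_real C * H)
   = of_real (K * (x - y) * A) * G + of_real (K * (x - w) * C) * (H :: complex)"
  by (simp add: distrib_left mult.assoc)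

section \<open>The continuous \<open>q\<close>-Jacobi parameters\<close>

locale cont_q_jacobi_params =
  fixes q \<alpha> \<beta> :: real
  assumes q0: "0 < q" and q1: "q < 1" and \<alpha>: "\<alpha> > -1" and \<beta>: "\<beta> > -1"
begin

definition "s = q powr (1 / 2)"
definition "a = q powr (\<alpha> / 2 + 1 / 4)"
definition "b = - (q powr (\<beta> / 2 + 1 / 4))"

lemma pos: "s > 0" "a > 0" "b < 0"
  using q0 by (simp_all add: s_def a_def b_def)

lemma s_power: "s ^ j = q powr (real j / 2)"
  using q0 by (simp add: s_def powr_powr flip: powr_realpow)

lemma ab: "a * b = - (q powr ((\<alpha> + \<beta> + 1) / 2))"
  by (simp add: a_def b_def add_divide_distrib add_ac flip: powr_add)

lemma a2: "a\<^sup>2 = q powr (\<alpha> + 1 / 2)"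
  by (simp add: a_def power2_eq_square flip: powr_add)

lemma b2: "b\<^sup>2 = q powr (\<beta> + 1 / 2)"
  by (simp add: b_def power2_eq_square flip: powr_add)

lemma powr_ne_1: "x > 0 \<Longrightarrow> q powr x \<noteq> 1"
  using q0 q1 powr_less_one by fastforce

lemma s2: "s\<^sup>2 = q"
  using q0 by (simp add: s_power)

text \<open>The sign of \<open>b\<close> makes ab negative. The other expressions are, up to sign,
  powers of q with exponents (j+1)/2, (\<alpha>+\<beta>+2+j)/2 and \<alpha>+1+j, positive since
  \<alpha>, \<beta> > -1.\<close>

lemma real_nonvanishing:
  "s ^ Suc j \<noteq> 1" "a * b * s ^ j \<noteq> 1" "a * b * s ^ Suc j \<noteq> - 1" "a\<^sup>2 * s * (s\<^sup>2) ^ j \<noteq> 1"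
proof -
  show "s ^ Suc j \<noteq> 1" unfolding s_power by (rule powr_ne_1) simp
  have "a * b * s ^ j < 0" using pos by (simp add: mult_neg_pos mult_pos_neg)
  then show "a * b * s ^ j \<noteq> 1" by linarith
  have "a * b * s ^ Suc j = - (q powr ((\<alpha> + \<beta> + 1) / 2 + real (Suc j) / 2))"
    unfolding ab s_power powr_add by simp
  moreover have "(\<alpha> + \<beta> + 1) / 2 + real (Suc j) / 2 > 0"
  proof -
    have "\<alpha> + \<beta> + 2 + real j > 0" using \<alpha> \<beta> by linarith
    then show ?thesis by (simp add: field_simps)
  qed
  ultimately show "a * b * s ^ Suc j \<noteq> - 1" using powr_ne_1 by simp
  have "a\<^sup>2 * s * (s\<^sup>2) ^ j = q powr (\<alpha> + 1 / 2) * q powr (1 / 2) * q powr real j"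
    unfolding a2 s2 using q0 by (simp add: s_def powr_realpow)
  then have "a\<^sup>2 * s * (s\<^sup>2) ^ j = q powr (\<alpha> + 1 / 2 + 1 / 2 + real j)"
    by (simp only: powr_add)
  moreover have "\<alpha> + 1 / 2 + 1 / 2 + real j > 0" using \<alpha> by simp
  ultimately show "a\<^sup>2 * s * (s\<^sup>2) ^ j \<noteq> 1" using powr_ne_1 by metis
qed

sublocale jac_params "complex_of_real a" "complex_of_real b" "complex_of_real s"
proof
  fix j
  show "complex_of_real a \<noteq> 0" "complex_of_real s \<noteq> 0" using pos by auto
  have inj: "complex_of_real x \<noteq> 1" if "x \<noteq> 1" for x using that by simp
  show "complex_of_real s ^ Suc j \<noteq> 1"
    using inj[OF real_nonvanishing(1)[of j]] by (simp only: of_real_power simp_thms)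
  show "complex_of_real a * complex_of_real b * complex_of_real s ^ j \<noteq> 1"
    using inj[OF real_nonvanishing(2)[of j]] by (simp only: of_real_power of_real_mult simp_thms)
  have "complex_of_real (a * b * s ^ Suc j) \<noteq> complex_of_real (- 1)"
    using real_nonvanishing(3)[of j] by (simp only: of_real_eq_iff simp_thms)
  then show "complex_of_real a * complex_of_real b * complex_of_real s ^ Suc j \<noteq> - 1"
    by (simp only: of_real_power of_real_mult of_real_minus of_real_1 simp_thms)
  show "(complex_of_real a)\<^sup>2 * complex_of_real s * ((complex_of_real s)\<^sup>2) ^ j \<noteq> 1"
    using inj[OF real_nonvanishing(4)[of j]] by (simp only: of_real_power of_real_mult simp_thms)
qed

lemma of_real_qpoch: "complex_of_real (qpoch u r n) = qpoch (complex_of_real u) (complex_of_real r) n"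
  by (simp add: qpoch_def)

text \<open>The prefactor q^((\<alpha>/2+1/4)n) is a^n, and (ab; s)_n cancels against the first
  symbol in the Jacobi normalization, leaving \<open>h n\<close>.\<close>

lemma cont_q_jacobi_eq_P: "cont_q_jacobi q \<alpha> \<beta> (int n) = P n"
proof -
  define r where "r = complex_of_real (q powr (1 / 4))"
  have r: "r\<^sup>2 = complex_of_real s"
    by (simp add: r_def s_def power2_eq_square flip: of_real_mult powr_add)
  have an: "q powr ((\<alpha> / 2 + 1 / 4) * real n) = a ^ n"
    using q0 by (simp add: a_def powr_powr flip: powr_realpow)
  have "qpoch (a * b) s n \<noteq> 0"
    unfolding qpoch_eq_0 using real_nonvanishing(2) by auto
  then have "complex_of_real (q powr ((\<alpha> / 2 + 1 / 4) * real n) /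
          (qpoch (- (q powr ((\<alpha> + \<beta> + 1) / 2))) s n * qpoch q q n)) *
      (complex_of_real (qpoch (a * b) s n * qpoch (a\<^sup>2 * s) (s\<^sup>2) n / a ^ n)) =
      complex_of_real (qpoch (a\<^sup>2 * s) (s\<^sup>2) n / qpoch (s\<^sup>2) (s\<^sup>2) n)"
    unfolding of_real_mult[symmetric] of_real_eq_iff an ab[symmetric] s2 using pos by simp
  then have *: "complex_of_real (q powr ((\<alpha> / 2 + 1 / 4) * real n) /
          (qpoch (- (q powr ((\<alpha> + \<beta> + 1) / 2))) s n * qpoch q q n)) *
      (qpoch (complex_of_real a * complex_of_real b) (complex_of_real s) n *
       qpoch ((complex_of_real a)\<^sup>2 * complex_of_real s) ((complex_of_real s)\<^sup>2) n / complex_of_real a ^ n) = h n"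
    unfolding h_def by (simp only: of_real_qpoch of_real_mult of_real_divide of_real_power)
  have "cont_q_jacobi q \<alpha> \<beta> (int n) = smult (complex_of_real (q powr ((\<alpha> / 2 + 1 / 4) * real n) /
          (qpoch (- (q powr ((\<alpha> + \<beta> + 1) / 2))) s n * qpoch q q n)))
     (askey_wilson n (complex_of_real a) (complex_of_real b) r (- r) (complex_of_real s))"
    by (simp add: cont_q_jacobi_def s_def a_def b_def r_def)
  also have "\<dots> = P n"
    unfolding askey_wilson_eq_jac_sum[OF r s0] smult_smult * P_def ..
  finally show ?thesis .
qed

text \<open>Integer indices, so that the step from \<open>-1\<close> to \<open>0\<close> needs no separate treatment.\<close>
definition M :: "int \<Rightarrow> real" where
  "M j = q powr (- (of_int j / 2)) + q powr ((of_int j + \<alpha> + \<beta> + 1) / 2)"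

lemma eigenpoly_cont_q_jacobi: "eigenpoly (cont_q_jacobi q \<alpha> \<beta> j) (complex_of_real (M j))"
proof (cases "j < 0")
  case True
  then show ?thesis by (simp add: cont_q_jacobi_def eigenpoly_0)
next
  case False
  then obtain n where n: "j = int n" using nonneg_int_cases[of j] by auto
  have "inverse (s ^ n) = q powr (- (real n / 2))" by (simp add: s_power powr_minus)
  moreover have "a * b * s ^ n = - (q powr ((real n + \<alpha> + \<beta> + 1) / 2))"
    by (simp add: ab s_power add_divide_distrib add_ac flip: powr_add)
  ultimately have "M j = inverse (s ^ n) - a * b * s ^ n"
    unfolding M_def n of_int_of_nat_eq by simp
  then have "complex_of_real (M j) = \<mu> n" by (simp add: \<mu>_def)
  then show ?thesis using eigenpoly_P[of n] by (simp add: n cont_q_jacobi_eq_P)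
qed

text \<open>With M_j = u + t and M_(j+1) = u/s + ts, the difference is (1-s)(t - u/s). In the
  squares the cross term 2ut is the same, leaving (1-s^2)(t^2 - u^2/s^2).\<close>

lemma eigenvalue_step:
  "2 * s / (1 - s) * (M j - M (j + 1)) = gam q \<alpha> \<beta> j"
  "2 * s\<^sup>2 / (1 - s\<^sup>2) * ((M j)\<^sup>2 - (M (j + 1))\<^sup>2) = gam_tilde q \<alpha> \<beta> j"
proof -
  define u where "u = q powr (- (of_int j / 2))"
  define t where "t = q powr ((of_int j + \<alpha> + \<beta> + 1) / 2)"
  have s: "s \<noteq> 0" "1 - s \<noteq> 0" "1 - s\<^sup>2 \<noteq> 0"
    using pos real_nonvanishing(1)[of 0] real_nonvanishing(1)[of 1] by (auto simp: power2_eq_square)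
  have M0: "M j = u + t" by (simp add: M_def u_def t_def)
  have "q powr (- (of_int (j + 1) / 2)) = u / s"
    by (simp add: u_def s_def add_divide_distrib flip: powr_diff)
  moreover have ts: "q powr ((of_int (j + 1) + \<alpha> + \<beta> + 1) / 2) = t * s"
    by (simp add: t_def s_def add_divide_distrib flip: powr_add)
  ultimately have M1: "M (j + 1) = u / s + t * s" by (simp only: M_def)
  have g: "gam q \<alpha> \<beta> j = 2 * (t * s - u)"
    unfolding gam_def ts[symmetric] by (simp add: u_def algebra_simps)
  have "q powr (of_int j + \<alpha> + \<beta> + 2) = (t * s)\<^sup>2" "q powr (- of_int j) = u\<^sup>2"
    unfolding ts[symmetric] power2_eq_square by (simp_all add: u_def add_divide_distrib add_ac flip: powr_add)
  then have gt: "gam_tilde q \<alpha> \<beta> j = 2 * ((t * s)\<^sup>2 - u\<^sup>2)"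
    by (simp add: gam_tilde_def)
  show "2 * s / (1 - s) * (M j - M (j + 1)) = gam q \<alpha> \<beta> j"
    unfolding M0 M1 g using s by (simp add: field_simps)
  have "(M j)\<^sup>2 - (M (j + 1))\<^sup>2 = (1 - s\<^sup>2) * (t\<^sup>2 - u\<^sup>2 / s\<^sup>2)"
    unfolding M0 M1 using s(1) by (simp add: field_simps power2_eq_square)
  then show "2 * s\<^sup>2 / (1 - s\<^sup>2) * ((M j)\<^sup>2 - (M (j + 1))\<^sup>2) = gam_tilde q \<alpha> \<beta> j"
    unfolding gt using s by (simp add: power_mult_distrib right_diff_distrib)
qed

section \<open>The recurrence with the coefficients \<open>A_coeff\<close> and
  \<open>C_coeff\<close>\<close>

lemma A_coeff_Suc:
  assumes "N = s ^ Suc m"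
  shows "A_coeff q \<alpha> \<beta> (int (Suc m)) = (1 - s\<^sup>2 * N\<^sup>2) * (1 - (a * b * N)\<^sup>2) /
    (2 * a * (1 + a * b * N\<^sup>2) * (1 + a * b * s * N\<^sup>2))"
proof -
  have N2: "N\<^sup>2 = q powr real (Suc m)"
    unfolding assms s_power power2_eq_square powr_add[symmetric] by simp
  have "q powr (real (Suc m) + 1) = s\<^sup>2 * N\<^sup>2"
    using q0 by (simp only: N2 s2 powr_add powr_one mult.commute)
  moreover have "q powr (real (Suc m) + \<alpha> + \<beta> + 1) = (a * b * N)\<^sup>2"
    by (simp add: power_mult_distrib N2 a2 b2 algebra_simps flip: powr_add)
  moreover have "q powr (real (Suc m) + (\<alpha> + \<beta> + 1) / 2) = - (a * b * N\<^sup>2)"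
    by (simp add: ab N2 algebra_simps flip: powr_add)
  moreover have "q powr (real (Suc m) + (\<alpha> + \<beta> + 2) / 2) = - (a * b * s * N\<^sup>2)"
    by (simp add: ab N2 s_def algebra_simps add_divide_distrib flip: powr_add)
  ultimately show ?thesis
    unfolding A_coeff_def of_int_of_nat_eq by (simp add: a_def[symmetric] del: of_nat_Suc)
qed

lemma C_coeff_Suc:
  assumes "N = s ^ Suc m"
  shows "C_coeff q \<alpha> \<beta> (int (Suc m)) = a * (1 - a\<^sup>2 * N\<^sup>2 / s) * (1 - b\<^sup>2 * N\<^sup>2 / s) /
    (2 * (1 + a * b * N\<^sup>2 / s) * (1 + a * b * N\<^sup>2))"
proof -
  have N2: "N\<^sup>2 = q powr real (Suc m)"
    unfolding assms s_power power2_eq_square powr_add[symmetric] by simp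
  have "q powr (real (Suc m) + \<alpha>) = a\<^sup>2 * N\<^sup>2 / s"
    by (simp add: N2 a2 s_def algebra_simps flip: powr_add powr_diff)
  moreover have "q powr (real (Suc m) + \<beta>) = b\<^sup>2 * N\<^sup>2 / s"
    by (simp add: N2 b2 s_def algebra_simps flip: powr_add powr_diff)
  moreover have "q powr (real (Suc m) + (\<alpha> + \<beta> + 1) / 2) = - (a * b * N\<^sup>2)"
    by (simp add: ab N2 algebra_simps flip: powr_add)
  moreover have "q powr (real (Suc m) + (\<alpha> + \<beta>) / 2) = - (a * b * N\<^sup>2 / s)"
    by (simp add: ab N2 s_def algebra_simps add_divide_distrib flip: powr_add powr_diff)
  ultimately show ?thesis
    unfolding C_coeff_def of_int_of_nat_eq by (simp add: a_def[symmetric] del: of_nat_Suc)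
qed

text \<open>The quotient in question is (1 - (ab)^2)/(1 + ab). It equals 1 - ab, which is also the
  value prescribed when 1 + ab = 0.\<close>

lemma A_coeff_0: "A_coeff q \<alpha> \<beta> 0 = (1 - s\<^sup>2) * (1 - a * b) / (2 * a * (1 + a * b * s))"
proof -
  have abs: "q powr ((\<alpha> + \<beta> + 2) / 2) = - (a * b * s)"
    by (simp add: ab s_def add_divide_distrib add_ac flip: powr_add)
  have sq: "q powr (\<alpha> + \<beta> + 1) = (a * b)\<^sup>2"
    by (simp add: ab power2_eq_square flip: powr_add)
  show ?thesis
  proof (cases "\<alpha> + \<beta> = -1")
    case True
    then show ?thesis
      unfolding A_coeff_def using q0 by (simp add: abs ab s2 a_def[symmetric] s_def[symmetric])
  next
    case False
    then have "q powr ((\<alpha> + \<beta> + 1) / 2) \<noteq> 1"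
      using q0 q1 by (simp add: powr_eq_one_iff_gen)
    then have "1 + a * b \<noteq> 0" by (simp add: ab)
    moreover have "1 - (a * b)\<^sup>2 = (1 - a * b) * (1 + a * b)"
      by (simp add: power2_eq_square algebra_simps)
    moreover have "A_coeff q \<alpha> \<beta> 0 = (1 - s\<^sup>2) * (1 - (a * b)\<^sup>2) / (2 * a * (1 + a * b) * (1 + a * b * s))"
      unfolding A_coeff_def using False q0 by (simp add: abs sq ab s2 a_def[symmetric])
    ultimately show ?thesis by simp
  qed
qed

lemma cont_q_jacobi_recurrence:
  assumes "n \<ge> 0"
  obtains B where "\<And>x. x * poly (cont_q_jacobi q \<alpha> \<beta> n) x =
    complex_of_real (A_coeff q \<alpha> \<beta> n) * poly (cont_q_jacobi q \<alpha> \<beta> (n + 1)) x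
    + B * poly (cont_q_jacobi q \<alpha> \<beta> n) x
    + complex_of_real (C_coeff q \<alpha> \<beta> n) * poly (cont_q_jacobi q \<alpha> \<beta> (n - 1)) x"
proof -
  obtain j where j: "n = int j" using assms nonneg_int_cases by blast
  show thesis
  proof (cases j)
    \<comment> \<open>The polynomial at index -1 is zero, so the lower term vanishes even where the
      denominator of \<open>C_coeff\<close> is 0.\<close>
    case 0
    have "complex_of_real (A_coeff q \<alpha> \<beta> 0) = (1 - (complex_of_real s)\<^sup>2) * (1 - complex_of_real a * complex_of_real b) /
      (2 * complex_of_real a * (1 + complex_of_real a * complex_of_real b * complex_of_real s))"
      unfolding A_coeff_0 by simp
    then obtain B where "\<And>x. x * poly (P 0) x =
        complex_of_real (A_coeff q \<alpha> \<beta> 0) * poly (P 1) x + B * poly (P 0) x"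
      using P_recurrence_0 by blast
    then show thesis
      using that[of B] cont_q_jacobi_eq_P[of 0] cont_q_jacobi_eq_P[of 1]
      by (simp add: j 0) (simp add: cont_q_jacobi_def)
  next
    case (Suc m)
    define N where "N = s ^ Suc m"
    have N: "complex_of_real N = complex_of_real s ^ Suc m" unfolding N_def by (rule of_real_power)
    obtain B where "\<And>x. x * poly (P (Suc m)) x =
        complex_of_real (A_coeff q \<alpha> \<beta> n) * poly (P (Suc (Suc m))) x + B * poly (P (Suc m)) x
        + complex_of_real (C_coeff q \<alpha> \<beta> n) * poly (P m) x"
      unfolding j Suc A_coeff_Suc[OF N_def] C_coeff_Suc[OF N_def]
      using P_recurrence[OF N refl refl] by (auto simp: of_real_power)
    moreover have "n + 1 = int (Suc (Suc m))" "n - 1 = int m" "n = int (Suc m)" by (simp_all add: j Suc)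
    ultimately show thesis using that[of B] by (simp only: cont_q_jacobi_eq_P)
  qed
qed

section \<open>Both structure relations for the continuous q-Jacobi polynomials\<close>

lemma structure_q_half:
  assumes "n \<ge> 0" and z: "z \<noteq> 0" "z\<^sup>2 \<noteq> 1"
  shows "(v_fun q \<alpha> \<beta> z * zeval (cont_q_jacobi q \<alpha> \<beta> n) (complex_of_real s * z)
       - v_fun q \<alpha> \<beta> (inverse z) * zeval (cont_q_jacobi q \<alpha> \<beta> n) (z / complex_of_real s)) / (z - inverse z)
     = complex_of_real (gam q \<alpha> \<beta> n * A_coeff q \<alpha> \<beta> n) * zeval (cont_q_jacobi q \<alpha> \<beta> (n + 1)) z
       - complex_of_real (gam q \<alpha> \<beta> (n - 1) * C_coeff q \<alpha> \<beta> n) * zeval (cont_q_jacobi q \<alpha> \<beta> (n - 1)) z"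
proof -
  define K where "K = 2 * s / (1 - s)"
  \<comment> \<open>The step from n down to n - 1 is the step at n - 1 reversed, hence the minus
    sign before the lower term.\<close>
  have g: "K * (M n - M (n + 1)) = gam q \<alpha> \<beta> n" "K * (M n - M (n - 1)) = - gam q \<alpha> \<beta> (n - 1)"
    using eigenvalue_step(1)[of n] eigenvalue_step(1)[of "n - 1"] minus_mult_right[of K "M (n - 1) - M n"]
    by (simp_all add: K_def)
  obtain B where rec: "\<And>x. x * poly (cont_q_jacobi q \<alpha> \<beta> n) x =
    complex_of_real (A_coeff q \<alpha> \<beta> n) * poly (cont_q_jacobi q \<alpha> \<beta> (n + 1)) x
    + B * poly (cont_q_jacobi q \<alpha> \<beta> n) x
    + complex_of_real (C_coeff q \<alpha> \<beta> n) * poly (cont_q_jacobi q \<alpha> \<beta> (n - 1)) x"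
    using cont_q_jacobi_recurrence[OF assms(1)] by blast
  have v: "v_fun q \<alpha> \<beta> z = (1 - complex_of_real a * z) * (1 - complex_of_real b * z) * (1 - complex_of_real s * z\<^sup>2) / z\<^sup>2" for z
    by (simp add: v_fun_def a_def b_def s_def)
  have "2 * complex_of_real s / (1 - complex_of_real s) = complex_of_real K"
    by (simp add: K_def)
  note st = structure_relation_s[OF rec eigenpoly_cont_q_jacobi eigenpoly_cont_q_jacobi eigenpoly_cont_q_jacobi z,
      folded v, unfolded this]
  show ?thesis
    unfolding st of_real_combination g by simp
qed

lemma structure_q:
  assumes "n \<ge> 0" and z: "z \<noteq> 0" "z\<^sup>2 \<noteq> 1"
  shows "(v_tilde q \<alpha> \<beta> z * zeval (cont_q_jacobi q \<alpha> \<beta> n) ((complex_of_real s)\<^sup>2 * z)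
       - v_tilde q \<alpha> \<beta> (inverse z) * zeval (cont_q_jacobi q \<alpha> \<beta> n) (z / (complex_of_real s)\<^sup>2)) / (z - inverse z)
     = complex_of_real (gam_tilde q \<alpha> \<beta> n * A_coeff q \<alpha> \<beta> n) * zeval (cont_q_jacobi q \<alpha> \<beta> (n + 1)) z
       - complex_of_real (gam_tilde q \<alpha> \<beta> (n - 1) * C_coeff q \<alpha> \<beta> n) * zeval (cont_q_jacobi q \<alpha> \<beta> (n - 1)) z"
    (is "?L z = ?R z")
proof -
  define K where "K = 2 * s\<^sup>2 / (1 - s\<^sup>2)"
  have g: "K * ((M n)\<^sup>2 - (M (n + 1))\<^sup>2) = gam_tilde q \<alpha> \<beta> n"
    "K * ((M n)\<^sup>2 - (M (n - 1))\<^sup>2) = - gam_tilde q \<alpha> \<beta> (n - 1)"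
    using eigenvalue_step(2)[of n] eigenvalue_step(2)[of "n - 1"] minus_mult_right[of K "(M (n - 1))\<^sup>2 - (M n)\<^sup>2"]
    by (simp_all add: K_def)
  obtain B where rec: "\<And>x. x * poly (cont_q_jacobi q \<alpha> \<beta> n) x =
    complex_of_real (A_coeff q \<alpha> \<beta> n) * poly (cont_q_jacobi q \<alpha> \<beta> (n + 1)) x
    + B * poly (cont_q_jacobi q \<alpha> \<beta> n) x
    + complex_of_real (C_coeff q \<alpha> \<beta> n) * poly (cont_q_jacobi q \<alpha> \<beta> (n - 1)) x"
    using cont_q_jacobi_recurrence[OF assms(1)] by blast
  \<comment> \<open>The four parameters of the base q representation are a, as, b, bs; they arise
    here from V(z) V(sz).\<close>
  have "q powr (\<alpha> / 2 + 3 / 4) = a * s" "q powr (\<beta> / 2 + 3 / 4) = - (b * s)"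
    by (simp_all add: a_def b_def s_def add_ac flip: powr_add)
  then have v: "v_tilde q \<alpha> \<beta> z = (1 - complex_of_real a * z) * (1 - complex_of_real a * complex_of_real s * z)
      * (1 - complex_of_real b * z) * (1 - complex_of_real b * complex_of_real s * z) / z\<^sup>2" for z
    by (simp add: v_tilde_def a_def[symmetric]) (simp add: b_def)
  have "2 * (complex_of_real s)\<^sup>2 / (1 - (complex_of_real s)\<^sup>2) = complex_of_real K"
    by (simp add: K_def)
  note st = structure_relation_s_squared[OF rec eigenpoly_cont_q_jacobi eigenpoly_cont_q_jacobi eigenpoly_cont_q_jacobi,
      folded v, unfolded this]
  have zz: "z - inverse z \<noteq> 0"
    using z by (auto simp: field_simps power2_eq_square)
  \<comment> \<open>\<open>D^2\<close> is singular also where \<open>s z = \<plusminus>1\<close> or \<open>z = \<plusminus>s\<close>; these points are reached by continuity.\<close>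
  define S where "S = {0, 1, - 1, inverse (complex_of_real s), - inverse (complex_of_real s),
    complex_of_real s, - complex_of_real s}"
  show ?thesis
  proof (rule eq_of_eq_off_finite[where f = ?L and g = ?R and S = S])
    show "finite S" by (simp add: S_def)
    show "isCont ?L z" "isCont ?R z"
      unfolding v using z zz s0 by (auto intro!: continuous_intros isCont_zeval)
    fix y assume y: "y \<notin> S"
    then have y': "y \<noteq> 0" "y\<^sup>2 \<noteq> 1" "(complex_of_real s * y)\<^sup>2 \<noteq> 1" "(y / complex_of_real s)\<^sup>2 \<noteq> 1"
      using s0 unfolding power2_eq_1_iff by (auto simp: S_def field_simps)
    show "?L y = ?R y"
      unfolding st[OF y'] unfolding of_real_power[symmetric] of_real_combination g by simp
  qed
qed

end

theorem mainTheorem8: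
  fixes q \<alpha> \<beta> :: real and n :: int and z :: complex
  assumes "0 < q" "q < 1" "\<alpha> > -1" "\<beta> > -1" "n \<ge> 0"
    and "z \<noteq> 0" "z \<noteq> 1" "z \<noteq> -1"
  shows "(v_fun q \<alpha> \<beta> z * zeval (cont_q_jacobi q \<alpha> \<beta> n) (complex_of_real (q powr (1 / 2)) * z)
          - v_fun q \<alpha> \<beta> (inverse z)
              * zeval (cont_q_jacobi q \<alpha> \<beta> n) (complex_of_real (q powr (- 1 / 2)) * z))
         / (z - inverse z)
       = complex_of_real (gam q \<alpha> \<beta> n * A_coeff q \<alpha> \<beta> n) * zeval (cont_q_jacobi q \<alpha> \<beta> (n + 1)) z
         - complex_of_real (gam q \<alpha> \<beta> (n - 1) * C_coeff q \<alpha> \<beta> n)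
             * zeval (cont_q_jacobi q \<alpha> \<beta> (n - 1)) z
     \<and> (v_tilde q \<alpha> \<beta> z * zeval (cont_q_jacobi q \<alpha> \<beta> n) (complex_of_real q * z)
          - v_tilde q \<alpha> \<beta> (inverse z)
              * zeval (cont_q_jacobi q \<alpha> \<beta> n) (complex_of_real (inverse q) * z))
         / (z - inverse z)
       = complex_of_real (gam_tilde q \<alpha> \<beta> n * A_coeff q \<alpha> \<beta> n)
             * zeval (cont_q_jacobi q \<alpha> \<beta> (n + 1)) z
         - complex_of_real (gam_tilde q \<alpha> \<beta> (n - 1) * C_coeff q \<alpha> \<beta> n)
             * zeval (cont_q_jacobi q \<alpha> \<beta> (n - 1)) z"
proof -
  interpret cont_q_jacobi_params q \<alpha> \<beta> by standard (use assms in auto)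
  have z: "z \<noteq> 0" "z\<^sup>2 \<noteq> 1" using assms by (auto simp: power2_eq_1_iff)
  have "q powr (- 1 / 2) = inverse s"
    using powr_minus[of q "1 / 2"] by (simp add: s_def)
  then have 1: "complex_of_real (q powr (1 / 2)) = complex_of_real s"
    "complex_of_real (q powr (- 1 / 2)) * z = z / complex_of_real s"
    unfolding s_def[symmetric] by (simp_all only: of_real_inverse divide_inverse mult.commute)
  have "(complex_of_real s)\<^sup>2 = complex_of_real q"
    by (simp add: s2 flip: of_real_power)
  then have 2: "complex_of_real q * z = (complex_of_real s)\<^sup>2 * z"
    "complex_of_real (inverse q) * z = z / (complex_of_real s)\<^sup>2"
    by (simp_all add: divide_inverse mult.commute)
  show ?thesis
    unfolding 1 2 by (intro conjI structure_q_half structure_q \<open>n \<ge> 0\<close> z)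
qed

end
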